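(* The projective realisation space of $E_{44}$ is at least four dimensional: $\dim(\mathcal{R}_{proj}(E_{44}))\ge 4$. In particular, the $24$-cell (which is combinatorially equivalent to $E_{44}$) is not projectively unique.
   Context: For a $d$-polytope $P$ with $n$ vertices, the realisation space $\mathcal{R}(P)$ is the space of all sets of $n$ points in $\mathbb{R}^d$ whose convex hull is combinatorially equivalent to $P$ (has face lattice isomorphic to that of $P$); it is a subset of $\mathbb{R}^{d\cdot n}$. The projective realisation space $\mathcal{R}_{proj}(P)$ is the quotient space of $\mathcal{R}(P)$ in which two realisations are equivalent if there is a projective transformation mapping one onto the other. A polytope is projectively unique if any two of its geometric realisations are related by a projective transformation. $E_{44}$ is the combinatorial type of the $4$-polytope $E(C_4\times C_4)$ with $C_4$ a quadrilateral, where for a $d$-polytope $P$, $E(P)$ is obtained combinatorially from the boundary of $P$ by stellarly subdividing every facet and then merging the two facets of the subdivision that share a ridge (face of dimension $d-2$) of $P$. Explicitly, with $i,j\in\mathbb{Z}/4$, its $24$ vertices are $v_{ij}$, $v'_i$, $v''_j$, and its facets have vertex sets $\{v_{ij},v_{i+1,j},v_{i,j+1},v_{i+1,j+1},v'_i,v''_j\}$, $\{v_{ij}:j\in\mathbb{Z}/4\}\cup\{v'_{i-1},v'_i\}$ and $\{v_{ij}:i\in\mathbb{Z}/4\}\cup\{v''_{j-1},v''_j\}$. The regular $24$-cell is a realisation of $E_{44}$. *)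

theory Defs
  imports "HOL-Analysis.Analysis"
begin

section \<open>Combinatorial equivalence of polytopes\<close>

definition face_lattice :: "'a::real_vector set \<Rightarrow> 'a set set" where
  "face_lattice P = {F. F face_of P}"

definition inclusion_isomorphic :: "'a set set \<Rightarrow> 'b set set \<Rightarrow> bool" where
  "inclusion_isomorphic L M \<longleftrightarrow>
     (\<exists>\<phi>. bij_betw \<phi> L M \<and> (\<forall>F\<in>L. \<forall>G\<in>L. F \<subseteq> G \<longleftrightarrow> \<phi> F \<subseteq> \<phi> G))"

definition combinatorially_equivalent :: "'a::real_vector set \<Rightarrow> 'b::real_vector set \<Rightarrow> bool" where
  "combinatorially_equivalent P Q \<longleftrightarrow> inclusion_isomorphic (face_lattice P) (face_lattice Q)"

section \<open>Projective transformations\<close>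

text \<open>A projective transformation of \<open>'a\<close> is induced, in the affine chart \<open>x \<mapsto> (x, 1)\<close>, by a
  linear automorphism of \<open>'a \<times> real\<close>. It maps the set \<open>P\<close> onto \<open>Q\<close> when no point of \<open>P\<close> is
  sent to infinity and the image of \<open>P\<close> is \<open>Q\<close>. For polytopes it then also maps the vertex set
  of \<open>P\<close> onto that of \<open>Q\<close>.\<close>

definition projective_map ::
    "('a::real_vector \<times> real \<Rightarrow> 'a \<times> real) \<Rightarrow> 'a \<Rightarrow> 'a" where
  "projective_map f x = fst (f (x, 1)) /\<^sub>R snd (f (x, 1))"

definition projectively_equivalent :: "'a::real_vector set \<Rightarrow> 'a set \<Rightarrow> bool" where
  "projectively_equivalent P Q \<longleftrightarrow>
     (\<exists>f. linear f \<and> bij f \<and> (\<forall>x\<in>P. snd (f (x, 1)) \<noteq> 0) \<and> projective_map f ` P = Q)"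

definition projectively_unique :: "'a::euclidean_space set \<Rightarrow> bool" where
  "projectively_unique P \<longleftrightarrow>
     (\<forall>Q Q' :: 'a set. polytope Q \<and> combinatorially_equivalent Q P \<and>
             polytope Q' \<and> combinatorially_equivalent Q' P \<longrightarrow> projectively_equivalent Q Q')"

section \<open>Realisation spaces\<close>

text \<open>A combinatorial type of polytope with vertices \<open>'v\<close> is given by its face lattice, as a family
  of vertex sets. A point of the realisation space is a tuple of \<open>CARD('v)\<close> points of \<open>real^'d\<close>;
  the isomorphism of face lattices need not match the indexing of the points, and two tuples are
  identified as soon as their convex hulls are projectively equivalent.\<close>

definition realisation_space :: "'v::finite set set \<Rightarrow> ((real^'d)^'v) set" where
  "realisation_space L =
     {p. inclusion_isomorphic (face_lattice (convex hull (range (vec_nth p)))) L}"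

definition projective_rel :: "'v::finite set set \<Rightarrow> ((real^'d)^'v) rel" where
  "projective_rel L =
     {(p, q). p \<in> realisation_space L \<and> q \<in> realisation_space L \<and>
        projectively_equivalent (convex hull (range (vec_nth p))) (convex hull (range (vec_nth q)))}"

definition quotient_topology :: "'a topology \<Rightarrow> ('a \<Rightarrow> 'b) \<Rightarrow> 'b topology" where
  "quotient_topology X f =
     topology (\<lambda>U. U \<subseteq> f ` topspace X \<and> openin X {x \<in> topspace X. f x \<in> U})"

lemma openin_quotient_topology:
  "openin (quotient_topology X f) U \<longleftrightarrow>
     U \<subseteq> f ` topspace X \<and> openin X {x \<in> topspace X. f x \<in> U}"
proof -
  have "istopology (\<lambda>U. U \<subseteq> f ` topspace X \<and> openin X {x \<in> topspace X. f x \<in> U})"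
  proof -
    have I: "{x \<in> topspace X. f x \<in> S \<inter> T} =
        {x \<in> topspace X. f x \<in> S} \<inter> {x \<in> topspace X. f x \<in> T}" for S T
      by auto
    have U: "{x \<in> topspace X. f x \<in> \<Union>K} = (\<Union>S\<in>K. {x \<in> topspace X. f x \<in> S})" for K
      by auto
    show ?thesis
      unfolding istopology_def I U by (auto intro!: openin_Int openin_Union)
  qed
  then show ?thesis
    by (simp add: quotient_topology_def topology_inverse')
qed

lemma topspace_quotient_topology: "topspace (quotient_topology X f) = f ` topspace X"
proof -
  have "{x \<in> topspace X. f x \<in> f ` topspace X} = topspace X"
    by blast
  then have "openin (quotient_topology X f) (f ` topspace X)"
    by (simp add: openin_quotient_topology)
  then show ?thesis
    by (auto simp: topspace_def openin_quotient_topology dest: openin_subset)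
qed

lemma quotient_map_quotient_topology: "quotient_map X (quotient_topology X f) f"
  by (simp add: quotient_map_def topspace_quotient_topology openin_quotient_topology)

definition projective_realisation_space ::
    "'v::finite set set \<Rightarrow> ((real^'d)^'v) set topology" where
  "projective_realisation_space L =
     quotient_topology (top_of_set (realisation_space L)) (\<lambda>p. projective_rel L `` {p})"

text \<open>As for semialgebraic sets, the dimension is the largest \<open>k\<close> such that the space contains a
  homeomorphic copy of the open \<open>k\<close>-cell, that is, of \<open>k\<close>-dimensional Euclidean space.
  (The empty space gets dimension 0.)\<close>

definition cell_dimension :: "'a topology \<Rightarrow> enat" where
  "cell_dimension X = Sup {enat k | k. \<exists>f. embedding_map (Euclidean_space k) X f}"

section \<open>The polytope \<open>E\<^sub>4\<^sub>4\<close> and the 24-cell\<close>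

text \<open>Arithmetic in the type \<open>4\<close> is arithmetic modulo 4. \<open>V i j\<close> are the vertices of the product
  \<open>C\<^sub>4 \<times> C\<^sub>4\<close> of two quadrilaterals; \<open>V' i\<close> and \<open>V'' j\<close> subdivide its facets \<open>[i, i+1] \<times> C\<^sub>4\<close> and
  \<open>C\<^sub>4 \<times> [j, j+1]\<close>. The facets of \<open>E\<^sub>4\<^sub>4\<close> are the bipyramids over the ridges
  \<open>[i, i+1] \<times> [j, j+1]\<close>, \<open>{i} \<times> C\<^sub>4\<close> and \<open>C\<^sub>4 \<times> {j}\<close> of that product.\<close>

datatype e44_vertex = V "4" "4" | V' "4" | V'' "4"

instance e44_vertex :: finite
proof
  have "UNIV = range (\<lambda>(i, j). V i j) \<union> range V' \<union> range V''"
    using e44_vertex.exhaust by (auto simp: image_iff) metis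
  then show "finite (UNIV :: e44_vertex set)"
    by (metis finite finite_UnI finite_imageI)
qed

definition E44_facets :: "e44_vertex set set" where
  "E44_facets =
     {{V i j, V (i + 1) j, V i (j + 1), V (i + 1) (j + 1), V' i, V'' j} | i j. True} \<union>
     {{V i j | j. True} \<union> {V' (i - 1), V' i} | i. True} \<union>
     {{V i j | i. True} \<union> {V'' (j - 1), V'' j} | j. True}"

text \<open>Every face of a polytope is an intersection of facets, and conversely; the empty intersection
  is the polytope itself.\<close>

definition E44 :: "e44_vertex set set" where
  "E44 = {\<Inter>\<F> | \<F>. \<F> \<subseteq> E44_facets}"

text \<open>The regular 24-cell, with vertices the permutations of \<open>(\<plusminus>1, \<plusminus>1, 0, 0)\<close>.\<close>

definition cell24 :: "(real^4) set" where
  "cell24 = convex hull {x. (\<forall>i. x $ i \<in> {-1, 0, 1}) \<and> card {i. x $ i \<noteq> 0} = 2}"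

end

(*
  The realisations form a family over the cube (-1,1)^4: the sixteen vertices of [-1,1]^4 together
  with, for each coordinate k and a base point c, the two points obtained from c by reflecting its
  k-th coordinate in the hyperplanes x_k = 1 and x_k = -1. For c = 0 this is the regular 24-cell. A
  projective map between two members that respects the labels fixes the vertices of a cube, so it is
  the identity and the base points agree. There are only finitely many relabellings, and each of
  them relates base points by a closed partial injection, so on a small ball no two members of the
  family are projectively equivalent at all. The relation is closed also in the realisation space:
  in a limit of projective maps between realisations no vertex can be sent to zero, because the
  affine relations between the vertices would force all of them to zero. Hence a closed 4-ball
  embeds into the quotient.
*)
theory Submission
  imports Defs "HOL-Homology.Homology"
begin

text \<open>The apices are reflections because a facet over a ridge of the cube has to contain the
  apices beyond both sides that meet there. The affine functional that is 0 at the base point and 1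
  on a side is 2 at the reflected point beyond that side and 0 at the apices of the other
  coordinates. Adding the functionals of two adjacent sides gives 2 on their ridge and at both
  apices, whatever the base point is. No ball around the regular member works: x -> -x carries the
  member with base point c to the one with base point -c. Equivalence ignores labels, so the ball
  has to avoid such coincidences, and it is found without computing its centre. The ball is closed
  because the quotient is nowhere shown to be Hausdorff. Continuity and injectivity on a compact set
  are then not enough for an embedding, so the map is shown to be closed; compactness supplies
  convergent base points for the limit argument.\<close>

section \<open>Face lattices of polytopes given by inequalities\<close>

text \<open>Every set \<open>E J\<close> is a face, every nonempty face is some \<open>E J\<close>,
  and a face is the hull of the points \<open>p v\<close> in it. Hence \<open>\<phi>\<close> turns
  faces into intersections of the sets \<open>facet j\<close> without losing information. The
  hypothesis \<open>empty\<close> gives the empty face its place, as the intersection of all of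
  them.\<close>

lemma face_lattice_of_halfspaces:
  fixes p :: "'v::finite \<Rightarrow> 'a::euclidean_space" and h :: "'j::finite \<Rightarrow> 'a \<Rightarrow> real"
  assumes affine: "\<And>j x y t. h j ((1 - t) *\<^sub>R x + t *\<^sub>R y) = (1 - t) * h j x + t * h j y"
    and hull: "convex hull (range p) = {x. \<forall>j. h j x \<le> b j}"
    and facets: "\<And>j. facet j = {v. h j (p v) = b j}"
    and empty: "\<Inter>(range facet) = {}"
  shows "inclusion_isomorphic (face_lattice (convex hull (range p))) {\<Inter>\<F> | \<F>. \<F> \<subseteq> range facet}"
proof -
  define P where "P = convex hull (range p)"
  define \<phi> where "\<phi> F = {v. p v \<in> F}" for F
  define E where "E J = {x \<in> P. \<forall>j\<in>J. h j x = b j}" for J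
  have Ph: "x \<in> P \<longleftrightarrow> (\<forall>j. h j x \<le> b j)" for x
    using hull P_def by auto
  have pP: "p v \<in> P" for v
    unfolding P_def by (meson hull_inc rangeI)
  have face_hull: "F = convex hull (p ` \<phi> F)" if "F face_of P" for F
  proof -
    obtain S where S: "S \<subseteq> range p" "F = convex hull S"
      using face_of_convex_hull_subset[of "range p" F] \<open>F face_of P\<close>
      by (auto simp: P_def finite_imp_compact)
    have "S \<subseteq> p ` \<phi> F"
      using S by (auto simp: \<phi>_def image_iff) (metis S(1) hull_inc image_iff subsetD)
    moreover have "convex hull (p ` \<phi> F) \<subseteq> F"
      using that by (intro hull_minimal) (auto simp: \<phi>_def face_of_imp_convex)
    ultimately show ?thesis
      using S(2) hull_mono[of S "p ` \<phi> F" convex] by blast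
  qed
  have E_face: "E J face_of P" for J
    unfolding face_of_def
  proof (intro conjI ballI impI)
    show "E J \<subseteq> P" by (auto simp: E_def)
    show "convex (E J)"
    proof (rule convexI)
      fix x y u v :: _ assume *: "x \<in> E J" "y \<in> E J" "0 \<le> u" "0 \<le> v" "u + v = (1::real)"
      have u: "u = 1 - v" using * by simp
      have "convex P" by (simp add: P_def)
      then have "u *\<^sub>R x + v *\<^sub>R y \<in> P"
        using * by (auto simp: E_def convex_def)
      moreover have "h j (u *\<^sub>R x + v *\<^sub>R y) = b j" if "j \<in> J" for j
        using * that unfolding u affine by (simp add: E_def algebra_simps)
      ultimately show "u *\<^sub>R x + v *\<^sub>R y \<in> E J"
        by (simp add: E_def)
    qed
    fix x y z assume xy: "x \<in> P" "y \<in> P" and z: "z \<in> E J" "z \<in> open_segment x y"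
    then obtain t where t: "0 < t" "t < 1" "z = (1 - t) *\<^sub>R x + t *\<^sub>R y"
      by (auto simp: in_segment)
    have "h j x = b j \<and> h j y = b j" if "j \<in> J" for j
    proof -
      have e: "(1 - t) * h j x + t * h j y = b j"
        using that z t by (simp add: E_def affine)
      have le: "h j x \<le> b j" "h j y \<le> b j" using xy Ph by auto
      have "(1 - t) * (b j - h j x) + t * (b j - h j y) = 0"
        using e by (simp add: algebra_simps)
      moreover have "0 \<le> (1 - t) * (b j - h j x)" "0 \<le> t * (b j - h j y)"
        using t le by auto
      ultimately have "(1 - t) * (b j - h j x) = 0" "t * (b j - h j y) = 0"
        by linarith+
      then show ?thesis using t by auto
    qed
    then show "x \<in> E J" "y \<in> E J" using xy by (auto simp: E_def)
  qed
  have face_E: "\<exists>J. F = E J" if F: "F face_of P" "F \<noteq> {}" for F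
  proof -
    define tight where "tight x = {j. h j x = b j}" for x
    \<comment> \<open>A point of \<open>F\<close> with the fewest tight inequalities stands in for a
      relative interior point; the aim is \<open>F = E (tight x)\<close>.\<close>
    obtain x where x: "x \<in> F" and min: "\<And>y. y \<in> F \<Longrightarrow> card (tight x) \<le> card (tight y)"
      using F(2) ex_has_least_nat[of "\<lambda>x. x \<in> F" _ "\<lambda>x. card (tight x)"] by auto
    have xP: "x \<in> P" using x F(1) face_of_imp_subset by blast
    have "F \<subseteq> E (tight x)"
    proof
      fix y assume y: "y \<in> F"
      then have yP: "y \<in> P" using F(1) face_of_imp_subset by blast
      \<comment> \<open>Only what is tight at both ends is tight at the midpoint, so minimality at
        \<open>x\<close> yields \<open>tight x \<subseteq> tight y\<close>.\<close>
      define z where "z = (1 - 1/2) *\<^sub>R x + (1/2) *\<^sub>R y"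
      have "z \<in> F"
        using x y face_of_imp_convex[OF F(1)] by (auto simp: z_def convex_def)
      have hz: "h j z = (h j x + h j y) / 2" for j
        unfolding z_def affine by simp
      have "tight z \<subseteq> tight x \<inter> tight y"
      proof
        fix j assume "j \<in> tight z"
        moreover have "h j x \<le> b j" "h j y \<le> b j" using xP yP Ph by auto
        ultimately show "j \<in> tight x \<inter> tight y" by (auto simp: tight_def hz)
      qed
      moreover from this have "tight z = tight x"
        using min[OF \<open>z \<in> F\<close>] by (intro card_seteq) auto
      ultimately show "y \<in> E (tight x)"
        using yP by (auto simp: E_def tight_def)
    qed
    moreover have "E (tight x) \<subseteq> F"
    proof
      fix y assume y: "y \<in> E (tight x)"
      then have yP: "y \<in> P" by (simp add: E_def)
      \<comment> \<open>There is room to move from \<open>x\<close> away from \<open>y\<close>: what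
        is tight at \<open>x\<close> is tight at \<open>y\<close> and stays constant along the line,
        and the other inequalities have slack at \<open>x\<close>.\<close>
      have "\<exists>e>0. \<forall>j. h j x + e * (h j x - h j y) \<le> b j"
      proof -
        have "\<exists>e>0. h j x + e * (h j x - h j y) \<le> b j" for j
        proof (cases "j \<in> tight x")
          case True
          then show ?thesis using y by (auto simp: E_def tight_def intro!: exI[of _ 1])
        next
          case False
          then have "h j x < b j" using xP Ph by (auto simp: tight_def less_le)
          show ?thesis
          proof (cases "h j x \<le> h j y")
            case True
            then show ?thesis using \<open>h j x < b j\<close> by (intro exI[of _ 1]) auto
          next
            case False
            then show ?thesis using \<open>h j x < b j\<close>
              by (intro exI[of _ "(b j - h j x) / (h j x - h j y)"]) auto
          qed
        qed
        then obtain e where e: "\<And>j. e j > 0" "\<And>j. h j x + e j * (h j x - h j y) \<le> b j"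
          by metis
        define m where "m = Min (range e)"
        have "m > 0" using e(1) by (simp add: m_def)
        moreover have "h j x + m * (h j x - h j y) \<le> b j" for j
        proof (cases "h j x \<le> h j y")
          case True
          then have "m * (h j x - h j y) \<le> 0" using \<open>m > 0\<close> by (simp add: mult_le_0_iff)
          then show ?thesis using xP Ph by (smt (verit))
        next
          case False
          have "m \<le> e j" by (simp add: m_def)
          then have "m * (h j x - h j y) \<le> e j * (h j x - h j y)"
            using False by (intro mult_right_mono) auto
          then show ?thesis using e(2)[of j] by linarith
        qed
        ultimately show ?thesis by blast
      qed
      then obtain e where e: "e > 0" "\<And>j. h j x + e * (h j x - h j y) \<le> b j" by blast
      \<comment> \<open>The segment from \<open>y\<close> is prolonged beyond \<open>x\<close>, so
        that \<open>x\<close> is interior to it and the face property puts \<open>y\<close> into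
        \<open>F\<close>.\<close>
      define z where "z = (1 - (- e)) *\<^sub>R x + (- e) *\<^sub>R y"
      have "h j z = h j x + e * (h j x - h j y)" for j
        unfolding z_def affine by (simp add: algebra_simps)
      then have zP: "z \<in> P" using e Ph by auto
      show "y \<in> F"
      proof (cases "y = x")
        case True
        then show ?thesis using x by simp
      next
        case False
        have xz: "(1 + e) *\<^sub>R x = e *\<^sub>R y + z"
          by (simp add: z_def algebra_simps)
        have "x = (1 / (1 + e)) *\<^sub>R ((1 + e) *\<^sub>R x)" using e by simp
        also have "\<dots> = (e / (1 + e)) *\<^sub>R y + (1 / (1 + e)) *\<^sub>R z"
          unfolding xz by (simp add: algebra_simps)
        also have "e / (1 + e) = 1 - 1 / (1 + e)" using e by (simp add: field_simps)
        finally have "x = (1 - 1 / (1 + e)) *\<^sub>R y + (1 / (1 + e)) *\<^sub>R z" .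
        moreover have "y \<noteq> z"
        proof
          assume "y = z"
          then have "(1 + e) *\<^sub>R x = (1 + e) *\<^sub>R y" using xz by (simp add: algebra_simps)
          then show False using False e by simp
        qed
        ultimately have "x \<in> open_segment y z"
          using e by (auto simp: in_segment intro!: exI[of _ "1 / (1 + e)"])
        then show ?thesis using F(1) x yP zP unfolding face_of_def by blast
      qed
    qed
    ultimately show ?thesis by blast
  qed
  have \<phi>E: "\<phi> (E J) = \<Inter>(facet ` J)" for J
    by (auto simp: \<phi>_def E_def facets pP)
  have "\<phi> ` face_lattice P = {\<Inter>\<F> | \<F>. \<F> \<subseteq> range facet}"
  proof (intro equalityI subsetI)
    fix A assume "A \<in> \<phi> ` face_lattice P"
    then obtain F where F: "F face_of P" "A = \<phi> F" by (auto simp: face_lattice_def)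
    show "A \<in> {\<Inter>\<F> | \<F>. \<F> \<subseteq> range facet}"
    proof (cases "F = {}")
      case True
      then have "A = \<Inter>(range facet)" using F empty by (simp add: \<phi>_def)
      then show ?thesis by blast
    next
      case False
      then obtain J where "F = E J" using face_E F by blast
      then have "A = \<Inter>(facet ` J)" using F \<phi>E by simp
      then show ?thesis by blast
    qed
  next
    fix A assume "A \<in> {\<Inter>\<F> | \<F>. \<F> \<subseteq> range facet}"
    then obtain J where "A = \<Inter>(facet ` J)" by (auto simp: subset_image_iff)
    then show "A \<in> \<phi> ` face_lattice P"
      using \<phi>E[of J] E_face[of J] by (auto simp: face_lattice_def image_iff)
  qed
  moreover have "F \<subseteq> G \<longleftrightarrow> \<phi> F \<subseteq> \<phi> G" if "F \<in> face_lattice P" "G \<in> face_lattice P" for F G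
  proof
    assume "\<phi> F \<subseteq> \<phi> G"
    then show "F \<subseteq> G"
      using face_hull that hull_mono[of "p ` \<phi> F" "p ` \<phi> G" convex]
      by (auto simp: face_lattice_def)
  qed (auto simp: \<phi>_def)
  ultimately show ?thesis
    unfolding inclusion_isomorphic_def bij_betw_def P_def[symmetric]
    by (intro exI[of _ \<phi>]) (auto simp: inj_on_def subset_antisym)
qed

section \<open>A four-parameter vert_tuple of realisations\<close>

text \<open>The points \<open>(sx i, sy i)\<close> run cyclically through the vertices of the square \<open>[-1,1]\<^sup>2\<close>, and
  \<open>(ax i s, ay i t)\<close> through the reflections of \<open>(s, t)\<close> in its sides. The reflection \<open>i\<close> lies beyond
  the side from vertex \<open>i\<close> to vertex \<open>i + 1\<close>, and vertex \<open>i\<close> is the midpoint of the reflections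
  \<open>i - 1\<close> and \<open>i\<close>.\<close>

definition sx :: "4 \<Rightarrow> real" where "sx i = (if i = 0 \<or> i = 1 then 1 else - 1)"
definition sy :: "4 \<Rightarrow> real" where "sy i = (if i = 1 \<or> i = 2 then 1 else - 1)"
definition ax :: "4 \<Rightarrow> real \<Rightarrow> real" where
  "ax i t = (if i = 0 then 2 - t else if i = 2 then - 2 - t else t)"
definition ay :: "4 \<Rightarrow> real \<Rightarrow> real" where
  "ay i t = (if i = 1 then 2 - t else if i = 3 then - 2 - t else t)"

primrec vert :: "real^4 \<Rightarrow> e44_vertex \<Rightarrow> real^4" where
  "vert c (V i j) = vector [sx i, sy i, sx j, sy j]"
| "vert c (V' i) = vector [ax i (c$1), ay i (c$2), c$3, c$4]"
| "vert c (V'' j) = vector [c$1, c$2, ax j (c$3), ay j (c$4)]"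

text \<open>As a function of \<open>(x, y)\<close> this is the affine functional that vanishes at the centre \<open>(c, d)\<close> and
  is \<open>1\<close> on the side from vertex \<open>i\<close> to vertex \<open>i + 1\<close>.\<close>

definition quad_gauge :: "real \<Rightarrow> real \<Rightarrow> 4 \<Rightarrow> real \<Rightarrow> real \<Rightarrow> real" where
  "quad_gauge c d i x y =
     (if i = 0 then (x - c) / (1 - c) else if i = 1 then (y - d) / (1 - d)
      else if i = 2 then (c - x) / (1 + c) else (d - y) / (1 + d))"

text \<open>On a facet the form is 2: both gauges are 1 on the ridge, and at an apex one gauge is 2
  and the other 0. The pair \<open>i - 1\<close>, \<open>i\<close> occurs because these are the two
  sides that meet in vertex \<open>i\<close> of the square.\<close>

primrec facet_form :: "real^4 \<Rightarrow> e44_vertex \<Rightarrow> real^4 \<Rightarrow> real" where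
  "facet_form c (V i j) x = quad_gauge (c$1) (c$2) i (x$1) (x$2) + quad_gauge (c$3) (c$4) j (x$3) (x$4)"
| "facet_form c (V' i) x = quad_gauge (c$1) (c$2) (i - 1) (x$1) (x$2) + quad_gauge (c$1) (c$2) i (x$1) (x$2)"
| "facet_form c (V'' j) x = quad_gauge (c$3) (c$4) (j - 1) (x$3) (x$4) + quad_gauge (c$3) (c$4) j (x$3) (x$4)"

text \<open>The facets are indexed by the vertices, reflecting the self-duality of the 24-cell.\<close>

primrec facet :: "e44_vertex \<Rightarrow> e44_vertex set" where
  "facet (V i j) = {V i j, V (i + 1) j, V i (j + 1), V (i + 1) (j + 1), V' i, V'' j}"
| "facet (V' i) = {V i j | j. True} \<union> {V' (i - 1), V' i}"
| "facet (V'' j) = {V i j | i. True} \<union> {V'' (j - 1), V'' j}"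

definition unit_box :: "(real^4) set" where
  "unit_box = {c. \<forall>k. \<bar>c$k\<bar> < 1}"

section \<open>Values of the facet functionals at the vertices\<close>

lemma forall_Z4: "(\<forall>i::4. P i) \<longleftrightarrow> P 0 \<and> P 1 \<and> P 2 \<and> P 3"
proof -
  have "(4::4) = 0" by simp
  then show ?thesis using forall_4[of P] by metis
qed

lemma exhaust_Z4: "(i::4) = 0 \<or> i = 1 \<or> i = 2 \<or> i = 3"
proof -
  have "(4::4) = 0" by simp
  then show ?thesis using exhaust_4[of i] by metis
qed

lemma E44_facets_eq: "E44_facets = range facet"
proof (intro equalityI subsetI)
  fix A assume "A \<in> E44_facets"
  then consider i j where "A = facet (V i j)" | i where "A = facet (V' i)" | j where "A = facet (V'' j)"
    unfolding E44_facets_def facet.simps by blast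
  then show "A \<in> range facet" by cases blast+
next
  fix A assume "A \<in> range facet"
  then obtain w where w: "A = facet w" by blast
  show "A \<in> E44_facets"
    unfolding w E44_facets_def by (cases w) (simp_all only: facet.simps, blast+)
qed

text \<open>In the type \<open>4\<close> the numeral \<open>4\<close> equals \<open>0\<close>, and
  simplification may turn one into the other; the last component is therefore listed under both
  indices.\<close>

lemma vector_4 [simp]:
  "(vector [a, b, c, d] :: 'a::zero^4) $ 1 = a"
  "(vector [a, b, c, d] :: 'a::zero^4) $ 2 = b"
  "(vector [a, b, c, d] :: 'a::zero^4) $ 3 = c"
  "(vector [a, b, c, d] :: 'a::zero^4) $ 4 = d"
  "(vector [a, b, c, d] :: 'a::zero^4) $ 0 = d"
proof -
  show 4: "(vector [a, b, c, d] :: 'a::zero^4) $ 4 = d"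
    by (simp add: vector_def)
  have "(4::4) = 0" by simp
  then show "(vector [a, b, c, d] :: 'a::zero^4) $ 0 = d"
    using 4 by metis
qed (simp_all add: vector_def)

lemma quad_gauge_affine:
  "quad_gauge c d i ((1 - t) * x + t * x') ((1 - t) * y + t * y') =
     (1 - t) * quad_gauge c d i x y + t * quad_gauge c d i x' y'"
proof -
  have "((1 - t) * a + t * a' - e) / f = (1 - t) * ((a - e) / f) + t * ((a' - e) / f)"
    "(e - ((1 - t) * a + t * a')) / f = (1 - t) * ((e - a) / f) + t * ((e - a') / f)"
    for a a' e f :: real
    by (simp_all add: diff_divide_distrib add_divide_distrib algebra_simps)
  then show ?thesis by (simp add: quad_gauge_def)
qed

lemma facet_form_affine:
  "facet_form c w ((1 - t) *\<^sub>R x + t *\<^sub>R y) = (1 - t) * facet_form c w x + t * facet_form c w y"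
proof -
  have component: "((1 - t) *\<^sub>R x + t *\<^sub>R y)$k = (1 - t) * x$k + t * y$k" for k
    by simp
  show ?thesis
    by (cases w) (simp_all only: facet_form.simps component quad_gauge_affine distrib_left add.assoc add.left_commute)
qed

lemma quad_gauge_cases:
  assumes "\<bar>c\<bar> < 1" "\<bar>d\<bar> < 1"
  shows quad_gauge_centre: "quad_gauge c d i c d = 0"
    and quad_gauge_square: "if k = i \<or> k = i + 1 then quad_gauge c d i (sx k) (sy k) = 1
           else quad_gauge c d i (sx k) (sy k) < 0"
    and quad_gauge_apex: "if k = i then quad_gauge c d i (ax k c) (ay k d) = 2
           else if k = i + 2 then quad_gauge c d i (ax k c) (ay k d) < 0
           else quad_gauge c d i (ax k c) (ay k d) = 0"
proof -
  have "1 - c > 0" "1 + c > 0" "1 - d > 0" "1 + d > 0" using assms by auto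
  then have *: "\<forall>i k. quad_gauge c d i c d = 0 \<and>
    (if k = i \<or> k = i + 1 then quad_gauge c d i (sx k) (sy k) = 1
           else quad_gauge c d i (sx k) (sy k) < 0) \<and>
    (if k = i then quad_gauge c d i (ax k c) (ay k d) = 2
           else if k = i + 2 then quad_gauge c d i (ax k c) (ay k d) < 0
           else quad_gauge c d i (ax k c) (ay k d) = 0)"
    unfolding forall_Z4 by (simp add: quad_gauge_def sx_def sy_def ax_def ay_def divide_simps)
  then show "quad_gauge c d i c d = 0"
    "if k = i \<or> k = i + 1 then quad_gauge c d i (sx k) (sy k) = 1
           else quad_gauge c d i (sx k) (sy k) < 0"
    "if k = i then quad_gauge c d i (ax k c) (ay k d) = 2
           else if k = i + 2 then quad_gauge c d i (ax k c) (ay k d) < 0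
           else quad_gauge c d i (ax k c) (ay k d) = 0"
    by blast+
qed

text \<open>Cube vertices give each gauge the value 1 or a negative one. An apex gives the gauges of
  its own plane 2, 0 or a negative value, and it sits at the centre of the other plane, where the
  gauges vanish. So two gauges add up to 2 only as 1 + 1 or 2 + 0, and never to more.\<close>

lemma facet_form_vert:
  assumes "c \<in> unit_box"
  shows "if v \<in> facet w then facet_form c w (vert c v) = 2 else facet_form c w (vert c v) < 2"
proof -
  have c: "\<bar>c$k\<bar> < 1" for k using assms by (simp add: unit_box_def)
  have centre: "quad_gauge (c$k) (c$l) i (c$k) (c$l) = 0" for k l i
    by (rule quad_gauge_centre[OF c c])
  have square: "if i' = i \<or> i' = i + 1 then quad_gauge (c$k) (c$l) i (sx i') (sy i') = 1
      else quad_gauge (c$k) (c$l) i (sx i') (sy i') < 0" for k l i i'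
    by (rule quad_gauge_square[OF c c])
  have apex: "if i' = i then quad_gauge (c$k) (c$l) i (ax i' (c$k)) (ay i' (c$l)) = 2
      else if i' = i + 2 then quad_gauge (c$k) (c$l) i (ax i' (c$k)) (ay i' (c$l)) < 0
      else quad_gauge (c$k) (c$l) i (ax i' (c$k)) (ay i' (c$l)) = 0" for k l i i'
    by (rule quad_gauge_apex[OF c c])
  show ?thesis
  proof (cases w)
    case (V i j)
    show ?thesis
    proof (cases v)
      case (V i' j')
      then show ?thesis using \<open>w = _\<close> square[of i' i 1 2] square[of j' j 3 4]
        by (auto split: if_splits)
    next
      case (V' i')
      then show ?thesis using \<open>w = _\<close> apex[of i' i 1 2] centre[of 3 4 j]
        by (auto split: if_splits)
    next
      case (V'' i')
      then show ?thesis using \<open>w = _\<close> apex[of i' j 3 4] centre[of 1 2 i]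
        by (auto split: if_splits)
    qed
  next
    case (V' i)
    show ?thesis
    proof (cases v)
      case (V i' j')
      then show ?thesis using \<open>w = _\<close> square[of i' i 1 2] square[of i' "i - 1" 1 2]
        by (auto split: if_splits)
    next
      case (V' i')
      have "\<forall>i i' :: 4. i' = i + 2 \<longrightarrow> i' \<noteq> i \<and> i' \<noteq> i - 1" by (simp add: forall_Z4)
      then show ?thesis using V' \<open>w = _\<close> apex[of i' i 1 2] apex[of i' "i - 1" 1 2]
        by (auto split: if_splits)
    next
      case (V'' i')
      then show ?thesis using \<open>w = _\<close> centre[of 1 2]
        by auto
    qed
  next
    case (V'' i)
    show ?thesis
    proof (cases v)
      case (V i' j')
      then show ?thesis using \<open>w = _\<close> square[of j' i 3 4] square[of j' "i - 1" 3 4]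
        by (auto split: if_splits)
    next
      case (V' i')
      then show ?thesis using \<open>w = _\<close> centre[of 3 4]
        by auto
    next
      case (V'' i')
      then show ?thesis using \<open>w = _\<close> apex[of i' i 3 4] apex[of i' "i - 1" 3 4]
        by (auto split: if_splits)
    qed
  qed
qed

text \<open>The coordinates are freed one at a time, each by interpolating between its values -1 and
  1. \<open>H\<close> is general because it is used both for a hull of vertices and for a slice of a
  linear subspace.\<close>

lemma cube_subset_convex:
  assumes "convex H" "\<And>i j. vector [sx i, sy i, sx j, sy j] \<in> H"
    and x: "\<And>k. \<bar>x$k\<bar> \<le> 1"
  shows "(x :: real^4) \<in> H"
proof -
  have segment: "((1 - t) / 2) *\<^sub>R u + ((1 + t) / 2) *\<^sub>R v \<in> H"
    if "u \<in> H" "v \<in> H" "\<bar>t\<bar> \<le> 1" for u v t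
    using that by (intro convexD[OF \<open>convex H\<close>]) (auto simp: field_simps)
  define W where "W b c d e = (vector [b, c, d, e] :: real^4)" for b c d e
  have "W b c d e \<in> H" if "\<bar>b\<bar> = 1" "\<bar>c\<bar> = 1" "\<bar>d\<bar> = 1" "\<bar>e\<bar> = 1" for b c d e
  proof -
    have "\<exists>i. b = sx i \<and> c = sy i" if "\<bar>b\<bar> = 1" "\<bar>c\<bar> = 1" for b c
    proof -
      have "b = sx 0 \<and> c = sy 0 \<or> b = sx 1 \<and> c = sy 1 \<or> b = sx 2 \<and> c = sy 2 \<or> b = sx 3 \<and> c = sy 3"
        using that by (auto simp: sx_def sy_def)
      then show ?thesis by blast
    qed
    then show ?thesis using assms(2) that by (metis W_def)
  qed
  note vertices = this
  have "W b c d e = ((1 - b) / 2) *\<^sub>R W (-1) c d e + ((1 + b) / 2) *\<^sub>R W 1 c d e"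
    "W b c d e = ((1 - c) / 2) *\<^sub>R W b (-1) d e + ((1 + c) / 2) *\<^sub>R W b 1 d e"
    "W b c d e = ((1 - d) / 2) *\<^sub>R W b c (-1) e + ((1 + d) / 2) *\<^sub>R W b c 1 e"
    "W b c d e = ((1 - e) / 2) *\<^sub>R W b c d (-1) + ((1 + e) / 2) *\<^sub>R W b c d 1"
    for b c d e
    by (simp_all add: W_def vec_eq_iff forall_4 field_simps)
  note split = this
  have 1: "W b c d e \<in> H" if "\<bar>b\<bar> \<le> 1" "\<bar>c\<bar> = 1" "\<bar>d\<bar> = 1" "\<bar>e\<bar> = 1" for b c d e
    by (subst split(1)) (intro segment vertices, use that in auto)
  have 2: "W b c d e \<in> H" if "\<bar>b\<bar> \<le> 1" "\<bar>c\<bar> \<le> 1" "\<bar>d\<bar> = 1" "\<bar>e\<bar> = 1" for b c d e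
    by (subst split(2)) (intro segment 1, use that in auto)
  have 3: "W b c d e \<in> H" if "\<bar>b\<bar> \<le> 1" "\<bar>c\<bar> \<le> 1" "\<bar>d\<bar> \<le> 1" "\<bar>e\<bar> = 1" for b c d e
    by (subst split(3)) (intro segment 2, use that in auto)
  have "W (x$1) (x$2) (x$3) (x$4) \<in> H"
    by (subst split(4)) (intro segment 3, use x in auto)
  moreover have "W (x$1) (x$2) (x$3) (x$4) = x"
    by (simp add: W_def vec_eq_iff forall_4)
  ultimately show ?thesis by simp
qed

text \<open>A point \<open>x\<close> beyond the side \<open>k\<close> of the cube lies on a segment from the apex \<open>w\<close> above that side to
  the cube; the number \<open>u\<close> measures how far beyond, with \<open>u = 1\<close> on the side and \<open>u = 2\<close> at the apex.\<close>

lemma apex_join: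
  fixes c x :: "real^4"
  assumes "convex H" and cube: "\<And>z. (\<And>k. \<bar>z$k\<bar> \<le> 1) \<Longrightarrow> z \<in> H"
    and w: "w \<in> H" "\<And>l. w$l = (if l = k then c$k + 2 * d else c$l)"
    and d: "d = 1 - c$k \<or> d = -1 - c$k" 
    and u: "x$k = c$k + u * d" "1 < u" "u \<le> 2"
    and l: "\<And>l. l \<noteq> k \<Longrightarrow> x$l - c$l \<le> (2 - u) * (1 - c$l)"
      "\<And>l. l \<noteq> k \<Longrightarrow> c$l - x$l \<le> (2 - u) * (1 + c$l)"
  shows "x \<in> H"
proof (cases "u = 2")
  case True
  have "x = w"
    unfolding vec_eq_iff
  proof
    fix l show "x$l = w$l"
      using u(1) l[of l] True by (cases "l = k") (simp_all add: w)
  qed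
  then show ?thesis using w by simp
next
  case False
  define s where "s = 2 - u"
  have s: "0 < s" "s < 1" using u False by (auto simp: s_def)
  \<comment> \<open>The point where the line from \<open>w\<close> through \<open>x\<close> reaches
    the cube. Its coordinate \<open>k\<close> is \<open>c$k + d\<close>, which is 1 or -1, and the
    hypotheses \<open>l\<close> bound the other coordinates.\<close>
  define z where "z = (1 / s) *\<^sub>R (x - (1 - s) *\<^sub>R w)"
  have "x = (1 - s) *\<^sub>R w + s *\<^sub>R z" using s by (simp add: z_def)
  moreover have "z \<in> H"
  proof (rule cube)
    fix l
    have sz: "s * z$l = x$l - (1 - s) * w$l" using s by (simp add: z_def)
    have "- s \<le> s * z$l \<and> s * z$l \<le> s"
    proof (cases "l = k")
      case True
      have "s * z$l = s * (c$k + d)"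
        unfolding sz using True by (simp add: w u s_def algebra_simps)
      then show ?thesis using d s by auto
    next
      case False
      then show ?thesis using l[OF False] unfolding sz by (simp add: w s_def algebra_simps)
    qed
    then have "s * (- 1) \<le> s * z$l" "s * z$l \<le> s * 1" by auto
    then have "- 1 \<le> z$l" "z$l \<le> 1"
      using mult_le_cancel_left_pos[OF s(1)] by blast+
    then show "\<bar>z$l\<bar> \<le> 1" by simp
  qed
  ultimately show ?thesis using \<open>convex H\<close> w s by (auto simp: convex_def)
qed

text \<open>For the hard inclusion, a point whose gauges are all at most 1 is in the cube. If a
  gauge exceeds 1, the inequalities bound all gauges of the other coordinates by 2 minus it, which
  is exactly what \<open>apex_join\<close> asks for.\<close>

lemma hull_vert:
  assumes "c \<in> unit_box"
  shows "convex hull (range (vert c)) = {x. \<forall>w. facet_form c w x \<le> 2}"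
proof (intro equalityI)
  have "convex {x. \<forall>w. facet_form c w x \<le> 2}"
  proof (rule convexI)
    fix x y u v :: _
    assume *: "x \<in> {x. \<forall>w. facet_form c w x \<le> 2}" "y \<in> {x. \<forall>w. facet_form c w x \<le> 2}"
      "0 \<le> u" "0 \<le> v" "u + v = (1::real)"
    have u: "u = 1 - v" using * by simp
    have "facet_form c w (u *\<^sub>R x + v *\<^sub>R y) \<le> 2" for w
      using convex_bound_le[of "facet_form c w x" 2 "facet_form c w y" u v] *
      unfolding u facet_form_affine by simp
    then show "u *\<^sub>R x + v *\<^sub>R y \<in> {x. \<forall>w. facet_form c w x \<le> 2}" by simp
  qed
  then show "convex hull (range (vert c)) \<subseteq> {x. \<forall>w. facet_form c w x \<le> 2}"
  proof (intro hull_minimal)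
    have "facet_form c w (vert c v) \<le> 2" for v w
      using facet_form_vert[OF assms, of v w] by (auto split: if_splits)
    then show "range (vert c) \<subseteq> {x. \<forall>w. facet_form c w x \<le> 2}" by blast
  qed
  define H where "H = convex hull (range (vert c))"
  have c: "\<bar>c$k\<bar> < 1" for k using assms by (simp add: unit_box_def)
  have pos: "1 - c$k > 0" "1 + c$k > 0" for k using c[of k] by auto
  have H: "convex H" "vert c v \<in> H" for v
    by (auto simp: H_def intro: hull_inc)
  have cube: "z \<in> H" if "\<And>k. \<bar>z$k\<bar> \<le> 1" for z
  proof (rule cube_subset_convex[OF H(1) _ that])
    show "vector [sx i, sy i, sx j, sy j] \<in> H" for i j
      using H(2)[of "V i j"] by simp
  qed
  show "{x. \<forall>w. facet_form c w x \<le> 2} \<subseteq> convex hull (range (vert c))"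
  proof
    fix x assume "x \<in> {x. \<forall>w. facet_form c w x \<le> 2}"
    then have x: "facet_form c w x \<le> 2" for w by simp
    \<comment> \<open>\<open>g k\<close> and \<open>g' k\<close> are the gauges of the sides where
      coordinate \<open>k\<close> is 1 and -1.\<close>
    define g where "g k = (x$k - c$k) / (1 - c$k)" for k
    define g' where "g' k = (c$k - x$k) / (1 + c$k)" for k
    \<comment> \<open>The 24 inequalities are the six pairs of coordinates with four choices of
      sides each: \<open>V'\<close> and \<open>V''\<close> cover the pairs within a plane,
      \<open>V\<close> the four mixed pairs.\<close>
    have gg: "g k + g l \<le> 2" "g k + g' l \<le> 2" "g' k + g l \<le> 2" "g' k + g' l \<le> 2"
      if "k \<noteq> l" for k l
    proof -
      have "\<forall>k l. k \<noteq> l \<longrightarrow> g k + g l \<le> 2 \<and> g k + g' l \<le> 2 \<and> g' k + g l \<le> 2 \<and> g' k + g' l \<le> 2"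
        using x[of "V 0 0"] x[of "V 0 1"] x[of "V 0 2"] x[of "V 0 3"]
          x[of "V 1 0"] x[of "V 1 1"] x[of "V 1 2"] x[of "V 1 3"]
          x[of "V 2 0"] x[of "V 2 1"] x[of "V 2 2"] x[of "V 2 3"]
          x[of "V 3 0"] x[of "V 3 1"] x[of "V 3 2"] x[of "V 3 3"]
          x[of "V' 0"] x[of "V' 1"] x[of "V' 2"] x[of "V' 3"]
          x[of "V'' 0"] x[of "V'' 1"] x[of "V'' 2"] x[of "V'' 3"]
        unfolding forall_4 by (simp add: quad_gauge_def g_def g'_def)
      then show "g k + g l \<le> 2" "g k + g' l \<le> 2" "g' k + g l \<le> 2" "g' k + g' l \<le> 2"
        using that by blast+
    qed
    have g_eq: "x$k - c$k = g k * (1 - c$k)" "c$k - x$k = g' k * (1 + c$k)" for k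
      using pos[of k] by (auto simp: g_def g'_def)
    have apex: "\<exists>v. \<forall>l. vert c v $ l = (if l = k then c$k + 2 * (1 - c$k) else c$l)"
      "\<exists>v. \<forall>l. vert c v $ l = (if l = k then c$k + 2 * (-1 - c$k) else c$l)" for k
    proof -
      have "k = 1 \<or> k = 2 \<or> k = 3 \<or> k = 4" by (rule exhaust_4)
      then have "(\<forall>l. vert c (if k = 1 then V' 0 else if k = 2 then V' 1 else if k = 3 then V'' 0 else V'' 1) $ l
             = (if l = k then c$k + 2 * (1 - c$k) else c$l)) \<and>
          (\<forall>l. vert c (if k = 1 then V' 2 else if k = 2 then V' 3 else if k = 3 then V'' 2 else V'' 3) $ l
             = (if l = k then c$k + 2 * (-1 - c$k) else c$l))"
        by (elim disjE) (simp_all add: forall_4 ax_def ay_def)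
      then show "\<exists>v. \<forall>l. vert c v $ l = (if l = k then c$k + 2 * (1 - c$k) else c$l)"
        "\<exists>v. \<forall>l. vert c v $ l = (if l = k then c$k + 2 * (-1 - c$k) else c$l)" by blast+
    qed
    \<comment> \<open>In any other coordinate one of the two gauges is nonnegative, so the partner
      in the sum is at most 2.\<close>
    have lower: "g k \<le> 2 \<and> g' k \<le> 2" for k
    proof -
      have l: "k + 1 \<noteq> k" by simp
      have "g (k + 1) \<ge> 0 \<or> g' (k + 1) \<ge> 0"
        using pos[of "k + 1"] by (auto simp: g_def g'_def zero_le_divide_iff)
      then show ?thesis using gg[OF l] gg[OF l[symmetric]] by linarith
    qed
    show "x \<in> convex hull (range (vert c))"
    proof (cases "\<exists>k. g k > 1 \<or> g' k > 1")
      case True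
      then obtain k where k: "g k > 1 \<or> g' k > 1" by blast
      have "x \<in> H"
      proof (cases "g k > 1")
        case True
        obtain v where v: "\<And>l. vert c v $ l = (if l = k then c$k + 2 * (1 - c$k) else c$l)"
          using apex(1) by blast
        show ?thesis
        proof (rule apex_join[OF H(1) cube H(2)[of v] v])
          show "x$k = c$k + g k * (1 - c$k)" using g_eq(1)[of k] by linarith
          fix l assume "l \<noteq> k"
          then show "x$l - c$l \<le> (2 - g k) * (1 - c$l)" "c$l - x$l \<le> (2 - g k) * (1 + c$l)"
            unfolding g_eq using gg[of k l] pos[of l] by (auto intro!: mult_right_mono)
        qed (use True lower in auto)
      next
        case False
        obtain v where v: "\<And>l. vert c v $ l = (if l = k then c$k + 2 * (-1 - c$k) else c$l)"
          using apex(2) by blast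
        show ?thesis
        proof (rule apex_join[OF H(1) cube H(2)[of v] v])
          show "x$k = c$k + g' k * (-1 - c$k)" using g_eq(2)[of k] by (simp add: algebra_simps)
          fix l assume "l \<noteq> k"
          then show "x$l - c$l \<le> (2 - g' k) * (1 - c$l)" "c$l - x$l \<le> (2 - g' k) * (1 + c$l)"
            unfolding g_eq using gg[of k l] pos[of l] by (auto intro!: mult_right_mono)
        qed (use False k lower in auto)
      qed
      then show ?thesis by (simp add: H_def)
    next
      case False
      have "x \<in> H"
      proof (rule cube)
        fix k
        have "g k \<le> 1" "g' k \<le> 1" using False not_less by blast+
        then have "g k * (1 - c$k) \<le> 1 * (1 - c$k)" "g' k * (1 + c$k) \<le> 1 * (1 + c$k)"
          using pos[of k] by (intro mult_right_mono; simp)+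
        then have "x$k - c$k \<le> 1 - c$k" "c$k - x$k \<le> 1 + c$k"
          unfolding g_eq by simp_all
        then show "\<bar>x$k\<bar> \<le> 1" by linarith
      qed
      then show ?thesis by (simp add: H_def)
    qed
  qed
qed

text \<open>These intersections make every singleton a member of \<open>E44\<close>, and the
  disjoint opposite facets make the empty set one.\<close>

lemma facet_Int:
  "facet (V' i) \<inter> facet (V'' j) = {V i j}"
  "facet (V' i) \<inter> facet (V' (i + 1)) = {V' i}"
  "facet (V'' j) \<inter> facet (V'' (j + 1)) = {V'' j}"
  "facet (V' i) \<inter> facet (V' (i + 2)) = {}"
proof -
  have "i \<noteq> i + 1" "i - 1 \<noteq> i + 1" "i \<noteq> i + 2" "i - 1 \<noteq> i + 2 - 1" "i - 1 \<noteq> i" "i - 1 \<noteq> i + 2" for i :: 4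
    by (simp_all add: algebra_simps)
  then show "facet (V' i) \<inter> facet (V'' j) = {V i j}"
    "facet (V' i) \<inter> facet (V' (i + 1)) = {V' i}"
    "facet (V'' j) \<inter> facet (V'' (j + 1)) = {V'' j}"
    "facet (V' i) \<inter> facet (V' (i + 2)) = {}"
    by auto
qed

lemma inclusion_isomorphic_vert:
  assumes "c \<in> unit_box"
  shows "inclusion_isomorphic (face_lattice (convex hull (range (vert c)))) E44"
proof -
  have "\<Inter>(range facet) \<subseteq> facet (V' 0) \<inter> facet (V' (0 + 2))" by blast
  then have "\<Inter>(range facet) = {}" unfolding facet_Int by blast
  have "v \<in> facet w \<longleftrightarrow> facet_form c w (vert c v) = 2" for v w
    using facet_form_vert[OF assms, of v w] by (simp split: if_splits)
  then have "facet w = {v. facet_form c w (vert c v) = 2}" for w by blast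
  from face_lattice_of_halfspaces[OF facet_form_affine hull_vert[OF assms] this
      \<open>\<Inter>(range facet) = {}\<close>]
  show ?thesis
    unfolding E44_def E44_facets_eq .
qed

section \<open>Vertices and dimension of arbitrary realisations\<close>

lemma Inter_facets_in_E44: "J \<subseteq> range facet \<Longrightarrow> \<Inter>J \<in> E44"
  unfolding E44_def E44_facets_eq by blast

text \<open>Besides the singletons, these are the links of a full flag: empty set, vertex, edge,
  triangle, facet, whole polytope. Its length will force dimension 4.\<close>

lemma E44_members: "{} \<in> E44" "UNIV \<in> E44" "{v} \<in> E44"
  "{V 0 0, V' 0} \<in> E44" "{V 0 0, V 0 1, V' 0} \<in> E44" "facet w \<in> E44"
proof -
  have Int: "facet u \<inter> facet w \<in> E44" for u w
    using Inter_facets_in_E44[of "{facet u, facet w}"] by simp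
  show "{} \<in> E44" using Int[of "V' 0" "V' (0 + 2)"] unfolding facet_Int .
  show "UNIV \<in> E44" using Inter_facets_in_E44[of "{}"] by simp
  show "facet w \<in> E44" using Int[of w w] by simp
  show "{v} \<in> E44"
  proof (cases v)
    case (V i j) then show ?thesis using Int[of "V' i" "V'' j"] unfolding facet_Int by simp
  next
    case (V' i) then show ?thesis using Int[of "V' i" "V' (i + 1)"] unfolding facet_Int by simp
  next
    case (V'' j) then show ?thesis using Int[of "V'' j" "V'' (j + 1)"] unfolding facet_Int by simp
  qed
  have "facet (V' 0) \<inter> facet (V 0 0) = {V 0 0, V 0 1, V' 0}" by auto
  then show "{V 0 0, V 0 1, V' 0} \<in> E44" using Int by metis
  have edge: "\<Inter>{facet (V' 0), facet (V 0 0), facet (V 0 (- 1))} = {V 0 0, V' 0}" by auto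
  show "{V 0 0, V' 0} \<in> E44"
    unfolding edge[symmetric] by (rule Inter_facets_in_E44) blast
qed

text \<open>A realisation is given by its face lattice alone, so that its points are distinct and
  are all vertices has to be extracted by counting: the 24 singletons of \<open>E44\<close> yield 24
  different extreme points, all of them among the at most 24 points \<open>q$v\<close>. Full
  dimension follows from a flag, along which the affine dimension increases strictly.\<close>

lemma
  fixes q :: "(real^4)^e44_vertex"
  assumes "q \<in> realisation_space E44"
  shows realisation_extreme: "q$v extreme_point_of convex hull (range (vec_nth q))"
    and realisation_inj: "inj (vec_nth q)"
    and realisation_affine_hull: "affine hull (range (vec_nth q)) = UNIV"
proof -
  define P where "P = convex hull (range (vec_nth q))"
  have "inclusion_isomorphic (face_lattice P) E44"
    using assms by (simp add: realisation_space_def P_def)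
  then obtain \<phi> where bij: "bij_betw \<phi> (face_lattice P) E44"
    and "\<forall>F\<in>face_lattice P. \<forall>G\<in>face_lattice P. F \<subseteq> G \<longleftrightarrow> \<phi> F \<subseteq> \<phi> G"
    unfolding inclusion_isomorphic_def by (elim exE conjE)
  then have mono: "F \<subseteq> G \<longleftrightarrow> \<phi> F \<subseteq> \<phi> G"
    if "F \<in> face_lattice P" "G \<in> face_lattice P" for F G
    using that by (elim ballE[of _ _ F] ballE[of _ _ G]) simp_all
  define \<psi> where "\<psi> = inv_into (face_lattice P) \<phi>"
  have \<psi>: "\<psi> A face_of P" "\<phi> (\<psi> A) = A" if "A \<in> E44" for A
  proof -
    have A: "A \<in> \<phi> ` face_lattice P" using that bij by (simp add: bij_betw_def)
    show "\<psi> A face_of P"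
      using inv_into_into[OF A] unfolding \<psi>_def by (simp add: face_lattice_def)
    show "\<phi> (\<psi> A) = A" using f_inv_into_f[OF A] unfolding \<psi>_def .
  qed
  have \<psi>_mono: "A \<subseteq> B \<longleftrightarrow> \<psi> A \<subseteq> \<psi> B" if "A \<in> E44" "B \<in> E44" for A B
    using mono[of "\<psi> A" "\<psi> B"] \<psi> that by (simp add: face_lattice_def)
  have face0: "{} \<in> face_lattice P" by (simp add: face_lattice_def)
  have \<phi>_empty: "\<phi> {} = {}"
    using mono[OF face0, of "\<psi> {}"] \<psi>[OF E44_members(1)] by (simp add: face_lattice_def)
  have compact: "compact P" by (simp add: P_def finite_imp_compact compact_convex_hull)
  have "\<exists>e. e extreme_point_of P \<and> \<phi> {e} = {v}" for v
  proof -
    \<comment> \<open>An extreme point \<open>e\<close> of this face is one of \<open>P\<close>; the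
      image of \<open>{e}\<close> is nonempty and contained in \<open>{v}\<close>, hence equal to
      it.\<close>
    let ?F = "\<psi> {v}"
    have F: "?F face_of P" "\<phi> ?F = {v}" using \<psi> E44_members(3) by auto
    then have "?F \<noteq> {}" using \<phi>_empty by force
    then obtain e where e: "e extreme_point_of ?F"
      using extreme_point_exists_convex[of ?F] F(1) compact
      by (metis P_def convex_convex_hull face_of_imp_compact face_of_imp_convex)
    then have eP: "e extreme_point_of P" using F(1) extreme_point_of_face by blast
    then have "{e} \<in> face_lattice P" by (simp add: face_lattice_def face_of_singleton)
    moreover have "?F \<in> face_lattice P" using F by (simp add: face_lattice_def)
    moreover have "e \<in> ?F" using e by (simp add: extreme_point_of_def)
    ultimately have "\<phi> {e} \<subseteq> {v}" using mono[of "{e}" ?F] F(2) by simp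
    moreover have "\<phi> {e} \<noteq> {}"
      using mono[of "{e}" "{}"] \<open>{e} \<in> face_lattice P\<close> face0 \<phi>_empty by auto
    ultimately show ?thesis using eP by blast
  qed
  then obtain e where e: "\<And>v. e v extreme_point_of P" "\<And>v. \<phi> {e v} = {v}" by metis
  have "inj e" using e(2) by (metis injI singleton_inject)
  have sub: "range e \<subseteq> range (vec_nth q)"
    using e(1) extreme_point_of_convex_hull unfolding P_def by blast
  have card_e: "card (range e) = CARD(e44_vertex)" using \<open>inj e\<close> by (simp add: card_image)
  have card_q: "card (range (vec_nth q)) \<le> CARD(e44_vertex)" by (rule card_image_le) simp
  have eq: "range e = range (vec_nth q)"
    using sub card_e card_q by (intro card_seteq) auto
  then show "q$v extreme_point_of convex hull (range (vec_nth q))"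
    using e(1) unfolding P_def by (metis rangeE rangeI)
  show "inj (vec_nth q)"
    using eq card_e by (intro eq_card_imp_inj_on) auto
  have strict: "aff_dim (\<psi> A) < aff_dim (\<psi> B)" if "A \<in> E44" "B \<in> E44" "A \<subset> B" for A B
  proof (rule face_of_aff_dim_lt)
    show "convex (\<psi> B)" using \<psi>(1)[OF that(2)] face_of_imp_convex by blast
    have "\<psi> A \<subseteq> \<psi> B" using \<psi>_mono that by blast
    then show "\<psi> A face_of \<psi> B"
      using \<psi>(1)[OF that(1)] \<psi>(1)[OF that(2)] by (meson face_of_imp_subset face_of_subset)
    show "\<psi> A \<noteq> \<psi> B"
    proof
      assume "\<psi> A = \<psi> B"
      then have "\<phi> (\<psi> A) = \<phi> (\<psi> B)" by simp
      then show False unfolding \<psi>(2)[OF that(1)] \<psi>(2)[OF that(2)] using that(3) by simp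
    qed
  qed
  have psubset: "A \<subset> B" if "A \<subseteq> B" "x \<in> B" "x \<notin> A" for A B :: "e44_vertex set" and x
    using that by auto
  have chain1: "{} \<subset> {V 0 0}"
    by (rule psubset[where x = "V 0 0"]) simp_all
  have chain2: "{V 0 0} \<subset> {V 0 0, V' 0}"
    by (rule psubset[where x = "V' 0"]) simp_all
  have chain3: "{V 0 0, V' 0} \<subset> {V 0 0, V 0 1, V' 0}"
    by (rule psubset[where x = "V 0 1"]) simp_all
  have chain4: "{V 0 0, V 0 1, V' 0} \<subset> facet (V 0 0)"
    by (rule psubset[where x = "V 1 1"]) simp_all
  have chain5: "facet (V 0 0) \<subset> UNIV"
    by (rule psubset[where x = "V' 1"]) simp_all
  note strict[OF E44_members(1,3) chain1] strict[OF E44_members(3,4) chain2]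
    strict[OF E44_members(4,5) chain3] strict[OF E44_members(5,6) chain4]
    strict[OF E44_members(6,2) chain5]
  \<comment> \<open>Five strict steps between integers, starting from at least -1, reach at least
    4.\<close>
  moreover have "- 1 \<le> aff_dim (\<psi> {})" by (rule aff_dim_geq)
  moreover have "aff_dim (\<psi> UNIV) \<le> aff_dim P"
    using \<psi>(1)[OF E44_members(2)] by (intro aff_dim_subset face_of_imp_subset)
  ultimately have "aff_dim P \<ge> 4" by linarith
  then have "aff_dim P = DIM(real^4)" using aff_dim_le_DIM[of P] by simp
  then show "affine hull (range (vec_nth q)) = UNIV"
    unfolding aff_dim_eq_full P_def by simp
qed

text \<open>An extreme point of the whole hull stays extreme in any smaller hull that contains it,
  and would then be one of its generators. This is how the limit argument uses that the target is a
  realisation.\<close>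

lemma realisation_notin_hull:
  fixes q :: "(real^4)^e44_vertex"
  assumes "q \<in> realisation_space E44" "v \<notin> K"
  shows "q$v \<notin> convex hull (vec_nth q ` K)"
proof
  assume *: "q$v \<in> convex hull (vec_nth q ` K)"
  have "convex hull (vec_nth q ` K) \<subseteq> convex hull (range (vec_nth q))" by (intro hull_mono) auto
  then have "q$v extreme_point_of convex hull (vec_nth q ` K)"
    using * realisation_extreme[OF assms(1), of v] by (auto simp: extreme_point_of_def subset_eq)
  then have "q$v \<in> vec_nth q ` K" by (rule extreme_point_of_convex_hull)
  then show False using realisation_inj[OF assms(1)] assms(2) by (auto simp: inj_def)
qed

text \<open>The slice of \<open>S\<close> at height 1 is affine, hence everything; multiples of
  \<open>(0, 1)\<close> then reach all other heights.\<close>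

lemma subspace_lift_UNIV:
  fixes q :: "'v \<Rightarrow> 'a::real_vector"
  assumes "affine hull (range q) = UNIV" "subspace S" "\<And>v. (q v, 1::real) \<in> S"
  shows "S = UNIV"
proof -
  have "affine {x. (x, 1) \<in> S}"
  proof (unfold affine_def, intro ballI allI impI)
    fix x y :: 'a and u v :: real assume *: "x \<in> {x. (x, 1) \<in> S}" "y \<in> {x. (x, 1) \<in> S}" "u + v = 1"
    have "u *\<^sub>R (x, 1) + v *\<^sub>R (y, 1) \<in> S"
      using * by (intro subspace_add subspace_scale \<open>subspace S\<close>) simp_all
    then show "u *\<^sub>R x + v *\<^sub>R y \<in> {x. (x, 1) \<in> S}" using *(3) by simp
  qed
  then have "affine hull (range q) \<subseteq> {x. (x, 1) \<in> S}"
    using assms(3) by (intro hull_minimal) auto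
  then have 1: "(x, 1) \<in> S" for x using assms(1) by auto
  have "(x, t) \<in> S" for x t
  proof -
    have "(x, 1) + (t - 1) *\<^sub>R (0, 1) \<in> S"
      using 1 \<open>subspace S\<close> by (intro subspace_add subspace_scale) auto
    then show ?thesis by simp
  qed
  then show ?thesis by auto
qed

section \<open>Projective equivalence\<close>

text \<open>The division-free form of \<open>projective_map\<close>: as a relation between points up
  to a nonzero factor it passes directly to inverses and composites.\<close>

definition projects :: "('a::real_vector \<times> real \<Rightarrow> 'a \<times> real) \<Rightarrow> 'a \<Rightarrow> 'a \<Rightarrow> bool" where
  "projects f x y \<longleftrightarrow> (\<exists>l\<noteq>0. f (x, 1) = l *\<^sub>R (y, 1))"

lemma scaleR_lift_eq_iff:
  fixes x y :: "'a::real_vector"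
  shows "a *\<^sub>R (x, 1::real) = b *\<^sub>R (y, 1) \<longleftrightarrow> a = b \<and> (a = 0 \<or> x = y)"
  unfolding scaleR_Pair prod.inject by auto

lemma projects_iff: "projects f x y \<longleftrightarrow> snd (f (x, 1)) \<noteq> 0 \<and> y = projective_map f x"
proof
  assume "projects f x y"
  then obtain l where "l \<noteq> 0" "f (x, 1) = l *\<^sub>R (y, 1)" by (auto simp: projects_def)
  then show "snd (f (x, 1)) \<noteq> 0 \<and> y = projective_map f x" by (simp add: projective_map_def)
next
  assume *: "snd (f (x, 1)) \<noteq> 0 \<and> y = projective_map f x"
  then have "f (x, 1) = snd (f (x, 1)) *\<^sub>R (y, 1)"
    by (simp add: projective_map_def prod_eq_iff)
  then show "projects f x y" using * unfolding projects_def by blast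
qed

lemma projectively_equivalent_iff:
  "projectively_equivalent P Q \<longleftrightarrow>
     (\<exists>f. linear f \<and> bij f \<and> (\<forall>x\<in>P. \<exists>y\<in>Q. projects f x y) \<and> (\<forall>y\<in>Q. \<exists>x\<in>P. projects f x y))"
proof -
  have "(\<forall>x\<in>P. snd (f (x, 1)) \<noteq> 0) \<and> projective_map f ` P = Q \<longleftrightarrow>
      (\<forall>x\<in>P. \<exists>y\<in>Q. projects f x y) \<and> (\<forall>y\<in>Q. \<exists>x\<in>P. projects f x y)" for f
    unfolding projects_iff by auto
  then show ?thesis unfolding projectively_equivalent_def by blast
qed

lemma projectively_equivalent_refl: "projectively_equivalent P P"
  unfolding projectively_equivalent_def
proof (intro exI[of _ id] conjI)
  show "projective_map id ` P = P" by (simp add: projective_map_def)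
qed (simp_all add: linear_id)

lemma projectively_equivalent_sym:
  fixes P Q :: "'a::euclidean_space set"
  assumes "projectively_equivalent P Q"
  shows "projectively_equivalent Q P"
proof -
  obtain f where f: "linear f" "bij f" "\<forall>x\<in>P. \<exists>y\<in>Q. projects f x y" "\<forall>y\<in>Q. \<exists>x\<in>P. projects f x y"
    using assms unfolding projectively_equivalent_iff by (elim exE conjE)
  have inv: "linear (inv_into UNIV f)" using f(1,2) inj_linear_imp_inv_linear bij_is_inj by blast
  have inv_projects: "projects (inv_into UNIV f) y x" if "projects f x y" for x y
  proof -
    obtain l where l: "l \<noteq> 0" "f (x, 1) = l *\<^sub>R (y, 1)" using \<open>projects f x y\<close> by (auto simp: projects_def)
    then have "f ((1 / l) *\<^sub>R (x, 1)) = (y, 1)"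
      by (simp only: linear_scale[OF f(1)]) simp
    then have "inv_into UNIV f (y, 1) = (1 / l) *\<^sub>R (x, 1)" using f(2) by (metis bij_inv_eq_iff)
    then show ?thesis using l(1) unfolding projects_def by (intro exI[of _ "1 / l"]) simp
  qed
  have "\<forall>y\<in>Q. \<exists>x\<in>P. projects (inv_into UNIV f) y x" using f(4) inv_projects by meson
  moreover have "\<forall>x\<in>P. \<exists>y\<in>Q. projects (inv_into UNIV f) y x" using f(3) inv_projects by meson
  ultimately show ?thesis
    unfolding projectively_equivalent_iff using inv bij_imp_bij_inv[OF f(2)]
    by (intro exI[of _ "inv_into UNIV f"] conjI)
qed

lemma projectively_equivalent_trans:
  assumes "projectively_equivalent P Q" "projectively_equivalent Q R"
  shows "projectively_equivalent P R"
proof -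
  obtain f where f: "linear f" "bij f" "\<forall>x\<in>P. \<exists>y\<in>Q. projects f x y" "\<forall>y\<in>Q. \<exists>x\<in>P. projects f x y"
    using assms(1) unfolding projectively_equivalent_iff by (elim exE conjE)
  obtain g where g: "linear g" "bij g" "\<forall>x\<in>Q. \<exists>y\<in>R. projects g x y" "\<forall>y\<in>R. \<exists>x\<in>Q. projects g x y"
    using assms(2) unfolding projectively_equivalent_iff by (elim exE conjE)
  have comp: "projects (g \<circ> f) x z" if xy: "projects f x y" and yz: "projects g y z" for x y z
  proof -
    obtain l where l: "l \<noteq> 0" "f (x, 1) = l *\<^sub>R (y, 1)" using xy unfolding projects_def by blast
    obtain m where m: "m \<noteq> 0" "g (y, 1) = m *\<^sub>R (z, 1)" using yz unfolding projects_def by blast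
    have "(g \<circ> f) (x, 1) = (l * m) *\<^sub>R (z, 1)"
      using l m linear_scale[OF g(1), of l "(y, 1)"] by simp
    then show ?thesis unfolding projects_def using l m by (intro exI[of _ "l * m"]) simp
  qed
  have "linear (g \<circ> f)" "bij (g \<circ> f)" using f g by (simp_all add: linear_compose bij_comp)
  moreover have "\<forall>x\<in>P. \<exists>z\<in>R. projects (g \<circ> f) x z" using f(3) g(3) comp by meson
  moreover have "\<forall>z\<in>R. \<exists>x\<in>P. projects (g \<circ> f) x z" using f(4) g(4) comp by meson
  ultimately show ?thesis
    unfolding projectively_equivalent_iff by (intro exI[of _ "g \<circ> f"] conjI)
qed

text \<open>A convex combination of \<open>l *\<^sub>R (y, 1)\<close> and
  \<open>l' *\<^sub>R (y', 1)\<close> is again a positive multiple of a lifted point, namely of a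
  mean of \<open>y\<close> and \<open>y'\<close> with weights shifted by \<open>l\<close> and
  \<open>l'\<close>. Positive factors keep the segment away from infinity.\<close>

lemma convex_projective_preimage:
  assumes "linear f" "convex C"
  shows "convex {x. \<exists>l>0. \<exists>y\<in>C. f (x, 1::real) = l *\<^sub>R (y, 1::real)}"
proof (rule convexI)
  fix x x' and u v :: real
  assume x: "x \<in> {x. \<exists>l>0. \<exists>y\<in>C. f (x, 1) = l *\<^sub>R (y, 1)}"
    and x': "x' \<in> {x. \<exists>l>0. \<exists>y\<in>C. f (x, 1) = l *\<^sub>R (y, 1)}"
    and uv: "0 \<le> u" "0 \<le> v" "u + v = 1"
  obtain l y where y: "l > 0" "y \<in> C" "f (x, 1) = l *\<^sub>R (y, 1)" using x by blast
  obtain l' y' where y': "l' > 0" "y' \<in> C" "f (x', 1) = l' *\<^sub>R (y', 1)" using x' by blast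
  define m where "m = u * l + v * l'"
  have "m > 0"
    using uv y(1) y'(1) unfolding m_def
    by (cases "u = 0") (auto intro: add_pos_nonneg)
  define z where "z = (u * l / m) *\<^sub>R y + (v * l' / m) *\<^sub>R y'"
  have "u * l / m + v * l' / m = 1"
    using \<open>m > 0\<close> by (simp add: m_def add_divide_distrib[symmetric])
  then have "z \<in> C"
    using \<open>convex C\<close> y y' uv \<open>m > 0\<close> unfolding z_def by (intro convexD) auto
  moreover have "f (u *\<^sub>R x + v *\<^sub>R x', 1) = m *\<^sub>R (z, 1)"
  proof -
    have "(u *\<^sub>R x + v *\<^sub>R x', 1) = u *\<^sub>R (x, 1) + v *\<^sub>R (x', 1::real)" using uv by simp
    then have "f (u *\<^sub>R x + v *\<^sub>R x', 1) = u *\<^sub>R f (x, 1) + v *\<^sub>R f (x', 1)"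
      using \<open>linear f\<close> by (simp only: linear_add linear_scale)
    also have "\<dots> = m *\<^sub>R (z, 1)"
      unfolding y(3) y'(3) using \<open>m > 0\<close> by (simp add: z_def scaleR_add_right m_def)
    finally show ?thesis .
  qed
  ultimately show "u *\<^sub>R x + v *\<^sub>R x' \<in> {x. \<exists>l>0. \<exists>y\<in>C. f (x, 1) = l *\<^sub>R (y, 1)}"
    using \<open>m > 0\<close> by blast
qed

text \<open>The normalisation \<open>norm T = 1\<close> makes limits of such maps exist; their invertibility is not
  part of the definition but follows when both point sets span.\<close>

definition labelled_equivalent ::
    "('v \<Rightarrow> 'v) \<Rightarrow> ('v \<Rightarrow> 'a::euclidean_space) \<Rightarrow> ('v \<Rightarrow> 'a) \<Rightarrow> bool" where
  "labelled_equivalent \<sigma> p q \<longleftrightarrow> (\<exists>T :: ('a \<times> real) \<Rightarrow>\<^sub>L ('a \<times> real). norm T = 1 \<and>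
     (\<forall>v. \<exists>l>0. blinfun_apply T (p v, 1) = l *\<^sub>R (q (\<sigma> v), 1)))"

lemma bij_of_labelled:
  fixes p q :: "'v \<Rightarrow> 'a::euclidean_space" and T :: "'a \<times> real \<Rightarrow> 'a \<times> real"
  assumes "linear T" "\<And>v. \<exists>l>0::real. T (p v, 1) = l *\<^sub>R (q (\<sigma> v), 1::real)"
    and "surj \<sigma>" "affine hull (range q) = UNIV"
  shows "bij T"
proof -
  have "subspace (range T)"
    using \<open>linear T\<close> by (simp add: linear_subspace_image)
  moreover have "(q w, 1) \<in> range T" for w
  proof -
    obtain v where "w = \<sigma> v" using \<open>surj \<sigma>\<close> by blast
    obtain l where "l > 0" "T (p v, 1) = l *\<^sub>R (q (\<sigma> v), 1)" using assms(2) by blast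
    then have "(q w, 1) = (1 / l) *\<^sub>R T (p v, 1)" using \<open>w = \<sigma> v\<close> by simp
    then have "(q w, 1) = T ((1 / l) *\<^sub>R (p v, 1))"
      by (simp only: linear_scale[OF \<open>linear T\<close>])
    then show ?thesis by blast
  qed
  ultimately have "surj T" using subspace_lift_UNIV[OF assms(4)] by blast
  then show ?thesis
    using linear_surj_imp_inj[of T] \<open>linear T\<close> by (simp add: bij_def)
qed

text \<open>With positive factors on the generating points, both the map and its inverse send hull
  into hull, by \<open>convex_projective_preimage\<close>.\<close>

lemma labelled_imp_projectively_equivalent:
  fixes p q :: "'v \<Rightarrow> 'a::euclidean_space"
  assumes "labelled_equivalent \<sigma> p q" "surj \<sigma>" "affine hull (range q) = UNIV"
  shows "projectively_equivalent (convex hull (range p)) (convex hull (range q))"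
proof -
  let ?P = "convex hull (range p)" and ?Q = "convex hull (range q)"
  obtain B :: "('a \<times> real) \<Rightarrow>\<^sub>L ('a \<times> real)" where
    B: "\<And>v. \<exists>l>0. blinfun_apply B (p v, 1) = l *\<^sub>R (q (\<sigma> v), 1)"
    using assms(1) unfolding labelled_equivalent_def by blast
  define T where "T = blinfun_apply B"
  have T: "linear T" "\<And>v. \<exists>l>0. T (p v, 1) = l *\<^sub>R (q (\<sigma> v), 1)"
    using B by (simp_all add: T_def bounded_linear.linear[OF blinfun.bounded_linear_right])
  have "bij T" by (rule bij_of_labelled[OF T assms(2,3)])
  then have inv: "linear (inv_into UNIV T)" using T(1) inj_linear_imp_inv_linear bij_is_inj by blast
  have into: "?P \<subseteq> {x. \<exists>l>0. \<exists>y\<in>?Q. T (x, 1) = l *\<^sub>R (y, 1)}"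
  proof (rule hull_minimal)
    show "range p \<subseteq> {x. \<exists>l>0. \<exists>y\<in>?Q. T (x, 1) = l *\<^sub>R (y, 1)}"
    proof
      fix x assume "x \<in> range p"
      then obtain v where v: "x = p v" by blast
      obtain l where "l > 0" "T (x, 1) = l *\<^sub>R (q (\<sigma> v), 1)" using T(2) v by blast
      moreover have "q (\<sigma> v) \<in> ?Q" by (simp add: hull_inc)
      ultimately show "x \<in> {x. \<exists>l>0. \<exists>y\<in>?Q. T (x, 1) = l *\<^sub>R (y, 1)}" by blast
    qed
    show "convex {x. \<exists>l>0. \<exists>y\<in>?Q. T (x, 1) = l *\<^sub>R (y, 1)}"
      by (rule convex_projective_preimage[OF T(1) convex_convex_hull])
  qed
  have "?Q \<subseteq> {y. \<exists>l>0. \<exists>x\<in>?P. inv_into UNIV T (y, 1) = l *\<^sub>R (x, 1)}"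
  proof (rule hull_minimal)
    show "range q \<subseteq> {y. \<exists>l>0. \<exists>x\<in>?P. inv_into UNIV T (y, 1) = l *\<^sub>R (x, 1)}"
    proof
      fix y assume "y \<in> range q"
      then obtain w where w: "y = q w" by blast
      obtain v where "w = \<sigma> v" using surjD[OF \<open>surj \<sigma>\<close>] by blast
      then have v: "y = q (\<sigma> v)" using w by simp
      obtain l where l: "l > 0" "T (p v, 1) = l *\<^sub>R (y, 1)" using T(2) v by blast
      then have "T ((1 / l) *\<^sub>R (p v, 1)) = (y, 1)"
        by (simp only: linear_scale[OF T(1)]) simp
      then have "inv_into UNIV T (y, 1) = (1 / l) *\<^sub>R (p v, 1)" using \<open>bij T\<close> by (metis bij_inv_eq_iff)
      moreover have "p v \<in> ?P" by (simp add: hull_inc)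
      ultimately show "y \<in> {y. \<exists>l>0. \<exists>x\<in>?P. inv_into UNIV T (y, 1) = l *\<^sub>R (x, 1)}"
        using l(1) by (auto intro!: exI[of _ "1 / l"] bexI[of _ "p v"])
    qed
    show "convex {y. \<exists>l>0. \<exists>x\<in>?P. inv_into UNIV T (y, 1) = l *\<^sub>R (x, 1)}"
      by (rule convex_projective_preimage[OF inv convex_convex_hull])
  qed
  moreover have "projects T x y" if inv_eq: "inv_into UNIV T (y, 1) = l *\<^sub>R (x, 1)" and "l > 0" for x y l
  proof -
    have "T (l *\<^sub>R (x, 1)) = (y, 1)" using inv_eq \<open>bij T\<close> by (metis bij_inv_eq_iff)
    then have "(y, 1) = l *\<^sub>R T (x, 1)" by (simp only: linear_scale[OF T(1)])
    then have "(1 / l) *\<^sub>R (y, 1) = T (x, 1)" using \<open>l > 0\<close> by (simp only: scaleR_scaleR) simp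
    then have "T (x, 1) = (1 / l) *\<^sub>R (y, 1)" by (rule sym)
    then show ?thesis using \<open>l > 0\<close> unfolding projects_def by (intro exI[of _ "1 / l"]) simp
  qed
  ultimately have onto: "\<forall>y\<in>?Q. \<exists>x\<in>?P. projects T x y" by blast
  have "\<forall>x\<in>?P. \<exists>y\<in>?Q. projects T x y"
  proof
    fix x assume "x \<in> ?P"
    then obtain l y where "l > 0" "y \<in> ?Q" "T (x, 1) = l *\<^sub>R (y, 1)" using into by blast
    then show "\<exists>y\<in>?Q. projects T x y" unfolding projects_def by (intro bexI exI[of _ l]) auto
  qed
  with onto show ?thesis
    unfolding projectively_equivalent_iff using T(1) \<open>bij T\<close> by (intro exI[of _ T] conjI)
qed

text \<open>The denominator has no zero on the convex set \<open>?P\<close>, so it has constant sign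
  there and can be made positive. Extreme points of \<open>?Q\<close> are then images of points
  \<open>p v\<close>, and counting turns this into a bijection of labels.\<close>

lemma projectively_equivalent_imp_labelled:
  fixes p q :: "'v::finite \<Rightarrow> 'a::euclidean_space"
  assumes "projectively_equivalent (convex hull (range p)) (convex hull (range q))"
    and "inj q" and extreme: "\<And>v. q v extreme_point_of convex hull (range q)"
  shows "\<exists>\<sigma>. bij \<sigma> \<and> labelled_equivalent \<sigma> p q"
proof -
  let ?P = "convex hull (range p)" and ?Q = "convex hull (range q)"
  obtain f where f: "linear f" "bij f" "\<forall>x\<in>?P. snd (f (x, 1)) \<noteq> 0" "projective_map f ` ?P = ?Q"
    using assms(1) unfolding projectively_equivalent_def by (elim exE conjE)
  then have f3: "\<And>x. x \<in> ?P \<Longrightarrow> snd (f (x, 1)) \<noteq> 0" by simp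
  have sign: "snd (f (x, 1)) * snd (f (y, 1)) > 0" if "x \<in> ?P" "y \<in> ?P" for x y
  proof (rule ccontr)
    let ?a = "snd (f (x, 1))" and ?b = "snd (f (y, 1))"
    assume "\<not> ?a * ?b > 0"
    then have "?a * ?b < 0" using f3 that by (metis linorder_neqE_linordered_idom mult_eq_0_iff)
    then have ab: "?a > 0 \<and> ?b < 0 \<or> ?a < 0 \<and> ?b > 0" "?a - ?b \<noteq> 0"
      by (auto simp: mult_less_0_iff)
    \<comment> \<open>The parameter at which a denominator with opposite signs at \<open>x\<close>
      and \<open>y\<close> would vanish on the segment.\<close>
    define t where "t = ?a / (?a - ?b)"
    have "1 - t = - ?b / (?a - ?b)" using ab(2) by (simp add: t_def field_simps)
    then have t: "0 \<le> t" "0 \<le> 1 - t" "(1 - t) + t = 1"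
      unfolding t_def using ab(1) by (auto simp: zero_le_divide_iff divide_le_0_iff)
    then have z: "(1 - t) *\<^sub>R x + t *\<^sub>R y \<in> ?P"
      using that by (intro convexD convex_convex_hull) auto
    have "((1 - t) *\<^sub>R x + t *\<^sub>R y, 1) = (1 - t) *\<^sub>R (x, 1) + t *\<^sub>R (y, 1::real)" by simp
    then have "f ((1 - t) *\<^sub>R x + t *\<^sub>R y, 1) = (1 - t) *\<^sub>R f (x, 1) + t *\<^sub>R f (y, 1)"
      using f(1) by (simp only: linear_add linear_scale)
    then have "snd (f ((1 - t) *\<^sub>R x + t *\<^sub>R y, 1)) = (1 - t) * ?a + t * ?b" by simp
    also have "\<dots> = 0" using ab(2) by (simp add: t_def field_simps)
    finally show False using f3[OF z] by simp
  qed
  obtain v0 :: 'v where True by blast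
  define s where "s = sgn (snd (f (p v0, 1)))"
  have pP: "p v \<in> ?P" for v by (simp add: hull_inc)
  have "s \<noteq> 0" using f3[OF pP] by (simp add: s_def sgn_zero_iff)
  have pos: "s * snd (f (x, 1)) > 0" if "x \<in> ?P" for x
    using sign[OF pP[of v0] that] by (auto simp: s_def sgn_if zero_less_mult_iff split: if_splits)
  have "f (p v0, 1) \<noteq> 0" using f3[OF pP[of v0]] by auto
  define B where "B = Blinfun f"
  have B: "blinfun_apply B = f"
    unfolding B_def using f(1)[unfolded linear_conv_bounded_linear] by (rule bounded_linear_Blinfun_apply)
  have "B \<noteq> 0" using \<open>f (p v0, 1) \<noteq> 0\<close> unfolding B[symmetric] by auto
  \<comment> \<open>Rescaling leaves the projective map unchanged; \<open>s\<close> makes the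
    factors positive and \<open>norm B\<close> normalises.\<close>
  define T where "T = (s / norm B) *\<^sub>R B"
  have "\<bar>s\<bar> = 1" using \<open>s \<noteq> 0\<close> by (simp add: s_def sgn_if split: if_splits)
  then have normT: "norm T = 1" using \<open>B \<noteq> 0\<close> by (simp add: T_def)
  have Tf: "blinfun_apply T (x, 1) = (s * snd (f (x, 1)) / norm B) *\<^sub>R (projective_map f x, 1)"
    if "x \<in> ?P" for x
  proof -
    have "f (x, 1) = snd (f (x, 1)) *\<^sub>R (projective_map f x, 1)"
      using f3[OF that] by (simp add: projective_map_def prod_eq_iff)
    then have "(s / norm B) *\<^sub>R f (x, 1) = (s / norm B) *\<^sub>R (snd (f (x, 1)) *\<^sub>R (projective_map f x, 1))"
      by simp
    then show ?thesis by (simp only: T_def B blinfun.scaleR_left scaleR_scaleR times_divide_eq_left)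
  qed
  have lpos: "s * snd (f (x, 1)) / norm B > 0" if "x \<in> ?P" for x
    using pos[OF that] \<open>B \<noteq> 0\<close> by simp
  have "?P \<subseteq> {x. \<exists>l>0. \<exists>y\<in>convex hull (range (projective_map f \<circ> p)). blinfun_apply T (x, 1) = l *\<^sub>R (y, 1)}"
  proof (rule hull_minimal)
    show "range p \<subseteq> {x. \<exists>l>0. \<exists>y\<in>convex hull (range (projective_map f \<circ> p)). blinfun_apply T (x, 1) = l *\<^sub>R (y, 1)}"
    proof
      fix x assume "x \<in> range p"
      then obtain v where v: "x = p v" by blast
      have "projective_map f (p v) \<in> convex hull (range (projective_map f \<circ> p))"
        by (rule hull_inc) auto
      then show "x \<in> {x. \<exists>l>0. \<exists>y\<in>convex hull (range (projective_map f \<circ> p)). blinfun_apply T (x, 1) = l *\<^sub>R (y, 1)}"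
        using Tf[OF pP[of v]] lpos[OF pP[of v]] v by blast
    qed
  qed (rule convex_projective_preimage[OF bounded_linear.linear[OF blinfun.bounded_linear_right] convex_convex_hull])
  note P_sub = this
  have Q_sub: "?Q \<subseteq> convex hull (range (projective_map f \<circ> p))"
  proof
    fix y assume "y \<in> ?Q"
    then obtain x where x: "x \<in> ?P" "y = projective_map f x" using f(4) by blast
    obtain l y' where "l > 0" "y' \<in> convex hull (range (projective_map f \<circ> p))"
      "blinfun_apply T (x, 1) = l *\<^sub>R (y', 1)" using P_sub x(1) by blast
    then have "(s * snd (f (x, 1)) / norm B) *\<^sub>R (y, 1) = l *\<^sub>R (y', 1::real)"
      using Tf[OF x(1)] unfolding x(2) by metis
    then have "y = y'" using \<open>l > 0\<close> unfolding scaleR_lift_eq_iff by (metis less_irrefl)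
    then show "y \<in> convex hull (range (projective_map f \<circ> p))"
      using \<open>y' \<in> _\<close> by simp
  qed
  have "range q \<subseteq> range (projective_map f \<circ> p)"
  proof
    fix y assume "y \<in> range q"
    then have y: "y extreme_point_of ?Q" using extreme by blast
    have sub: "convex hull (range (projective_map f \<circ> p)) \<subseteq> ?Q"
      using f(4) pP by (intro hull_minimal) auto
    with Q_sub have "?Q = convex hull (range (projective_map f \<circ> p))" by blast
    then show "y \<in> range (projective_map f \<circ> p)" using y extreme_point_of_convex_hull by metis
  qed
  moreover have "card (range (projective_map f \<circ> p)) \<le> card (range q)"
    using card_image[OF \<open>inj q\<close>] card_image_le[of "UNIV :: 'v set" "projective_map f \<circ> p"] by simp
  ultimately have eq: "range q = range (projective_map f \<circ> p)"
    by (intro card_seteq) auto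
  then have "\<forall>v. \<exists>w. projective_map f (p v) = q w" by (metis comp_apply rangeE rangeI)
  then obtain \<sigma> where \<sigma>: "\<And>v. projective_map f (p v) = q (\<sigma> v)" by metis
  have "surj \<sigma>"
  proof
    show "UNIV \<subseteq> range \<sigma>"
    proof
      fix w
      have "q w \<in> range (projective_map f \<circ> p)" using eq by blast
      then obtain v where "q w = q (\<sigma> v)" using \<sigma> by auto
      then show "w \<in> range \<sigma>" using \<open>inj q\<close> by (auto dest: injD)
    qed
  qed simp
  then have "bij \<sigma>" by (simp add: bij_def finite_UNIV_surj_inj)
  moreover have "labelled_equivalent \<sigma> p q"
    unfolding labelled_equivalent_def using normT Tf[OF pP] lpos[OF pP] \<sigma> by metis
  ultimately show ?thesis by blast
qed

section \<open>Limits of projective maps\<close>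

lemma vert_tuple_realisation:
  assumes "c \<in> unit_box"
  shows "(\<chi> v. vert c v) \<in> realisation_space E44"
  using inclusion_isomorphic_vert[OF assms] by (simp add: realisation_space_def vec_lambda_inverse)

lemma affine_hull_vert:
  assumes "c \<in> unit_box"
  shows "affine hull (range (vert c)) = UNIV"
  using realisation_affine_hull[OF vert_tuple_realisation[OF assms]]
  by (simp add: vec_lambda_inverse)

lemma tendsto_vert:
  assumes "(f \<longlongrightarrow> a) F"
  shows "((\<lambda>x. vert (f x) v) \<longlongrightarrow> vert a v) F"
proof (rule vec_tendstoI)
  fix k :: 4
  have f: "((\<lambda>x. f x $ k) \<longlongrightarrow> a $ k) F" for k using assms by (rule tendsto_vec_nth)
  have ax: "((\<lambda>x. ax i (f x $ k)) \<longlongrightarrow> ax i (a $ k)) F"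
    and ay: "((\<lambda>x. ay i (f x $ k)) \<longlongrightarrow> ay i (a $ k)) F" for i k
    unfolding ax_def ay_def by (auto intro!: tendsto_diff f)
  have "k = 1 \<or> k = 2 \<or> k = 3 \<or> k = 4" by (rule exhaust_4)
  then show "((\<lambda>x. vert (f x) v $ k) \<longlongrightarrow> vert a v $ k) F"
    by (cases v) (auto simp: ax ay f)
qed

text \<open>\<open>V i j\<close> is a product vertex: its first two coordinates depend on
  \<open>i\<close> only, its last two on \<open>j\<close> only.\<close>

lemma vert_parallelogram:
  "vert c (V i j) + vert c (V i' j') = vert c (V i j') + vert c (V i' j)"
  by (simp add: vec_eq_iff forall_4)

text \<open>The bilinear barycentric coordinates of the point \<open>(s, t)\<close> with respect to
  the corners of the square.\<close>

definition weight :: "real \<Rightarrow> real \<Rightarrow> 4 \<Rightarrow> real" where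
  "weight s t k = (1 + sx k * s) * (1 + sy k * t) / 4"

lemma sum_Z4: "(\<Sum>i::4\<in>UNIV. f i) = f 0 + f 1 + f 2 + f 3"
proof -
  have "(4::4) = 0" by simp
  then have "f 4 = f 0" by (rule arg_cong)
  then show ?thesis using sum_4[of f] by (simp only: ac_simps)
qed

text \<open>The axis of the bipyramid \<open>facet (V' i)\<close> meets its square base at the
  midpoint of the two apices, which has the last two coordinates of \<open>c\<close>. The factor 2
  keeps both sides at height 2 after lifting; \<open>V''\<close> is symmetric.\<close>

lemma vert_centre:
  "vert c (V' (i - 1)) + vert c (V' i) = (\<Sum>j\<in>UNIV. (2 * weight (c$3) (c$4) j) *\<^sub>R vert c (V i j))"
  "vert c (V'' (j - 1)) + vert c (V'' j) = (\<Sum>i\<in>UNIV. (2 * weight (c$1) (c$2) i) *\<^sub>R vert c (V i j))"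
  "(\<Sum>k\<in>UNIV. weight s t k) = 1"
proof -
  have "\<forall>i. vert c (V' (i - 1)) + vert c (V' i) = (\<Sum>j\<in>UNIV. (2 * weight (c$3) (c$4) j) *\<^sub>R vert c (V i j))"
    unfolding forall_Z4 sum_Z4
    by (simp add: vec_eq_iff forall_4 sx_def sy_def ax_def ay_def weight_def field_simps)
  then show "vert c (V' (i - 1)) + vert c (V' i) = (\<Sum>j\<in>UNIV. (2 * weight (c$3) (c$4) j) *\<^sub>R vert c (V i j))"
    by blast
  have "\<forall>j. vert c (V'' (j - 1)) + vert c (V'' j) = (\<Sum>i\<in>UNIV. (2 * weight (c$1) (c$2) i) *\<^sub>R vert c (V i j))"
    unfolding forall_Z4 sum_Z4
    by (simp add: vec_eq_iff forall_4 sx_def sy_def ax_def ay_def weight_def field_simps)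
  then show "vert c (V'' (j - 1)) + vert c (V'' j) = (\<Sum>i\<in>UNIV. (2 * weight (c$1) (c$2) i) *\<^sub>R vert c (V i j))"
    by blast
  show "(\<Sum>k\<in>UNIV. weight s t k) = 1"
    unfolding sum_Z4 by (simp add: sx_def sy_def weight_def field_simps)
qed

lemma weight_pos:
  assumes "\<bar>s\<bar> < 1" "\<bar>t\<bar> < 1"
  shows "weight s t k > 0"
proof -
  have "1 + sx k * s > 0" "1 + sy k * t > 0" using assms by (auto simp: sx_def sy_def)
  then show ?thesis by (simp add: weight_def)
qed

text \<open>If \<open>m\<close> were positive, dividing by it would exhibit \<open>x\<close> as a
  convex combination of the \<open>y k\<close>. Once \<open>m = 0\<close>, the nonnegative
  \<open>w k\<close> have sum 0.\<close>

lemma lifted_hull_zero: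
  fixes x :: "'a::real_vector"
  assumes eq: "m *\<^sub>R (x, 1) = (\<Sum>k\<in>K. w k *\<^sub>R (y k, 1::real))"
    and "finite K" "\<And>k. k \<in> K \<Longrightarrow> w k \<ge> 0" "x \<notin> convex hull (y ` K)"
  shows "m = 0" and "\<And>k. k \<in> K \<Longrightarrow> w k = 0"
proof -
  have m: "m = sum w K" and x: "m *\<^sub>R x = (\<Sum>k\<in>K. w k *\<^sub>R y k)"
    using arg_cong[OF eq, of snd] arg_cong[OF eq, of fst] by (simp_all add: snd_sum fst_sum)
  show "m = 0"
  proof (rule ccontr)
    assume "m \<noteq> 0"
    then have "m > 0" using m sum_nonneg[of K w] assms(3) by (metis less_eq_real_def)
    have "(1 / m) *\<^sub>R (m *\<^sub>R x) = (\<Sum>k\<in>K. (w k / m) *\<^sub>R y k)"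
      unfolding x by (simp add: scaleR_sum_right)
    moreover have "(\<Sum>k\<in>K. (w k / m) *\<^sub>R y k) \<in> convex hull (y ` K)"
    proof (rule convex_sum[OF \<open>finite K\<close> convex_convex_hull])
      show "(\<Sum>k\<in>K. w k / m) = 1" using m \<open>m > 0\<close> by (simp flip: sum_divide_distrib)
    qed (use assms(3) \<open>m > 0\<close> in \<open>auto intro: hull_inc\<close>)
    ultimately show False using \<open>x \<notin> _\<close> \<open>m > 0\<close> by simp
  qed
  then show "w k = 0" if "k \<in> K" for k
    using m that assms(2,3) sum_nonneg_eq_0_iff[of K w] by simp
qed

text \<open>If one factor \<open>l v\<close> vanishes, an affine relation between vertices turns into an expression of
  another vertex of \<open>q\<close> as a convex combination of further ones, which is only possible if all the
  factors involved vanish; the relations connect all vertices.\<close>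

lemma labelled_limit_positive:
  fixes q :: "(real^4)^e44_vertex" and T :: "(real^4) \<times> real \<Rightarrow> (real^4) \<times> real"
  assumes c: "c \<in> unit_box" and q: "q \<in> realisation_space E44" and "inj \<sigma>"
    and T: "linear T" "T z \<noteq> 0"
    and l: "\<And>v. l v \<ge> 0" "\<And>v. T (vert c v, 1) = l v *\<^sub>R (q$\<sigma> v, 1::real)"
  shows "l v > 0"
proof (rule ccontr)
  assume "\<not> l v > 0"
  then have lv: "l v = 0" using l(1)[of v] by simp
  define y where "y v = q$\<sigma> v" for v
  have Ty: "T (vert c v, 1) = l v *\<^sub>R (y v, 1)" for v using l(2) by (simp add: y_def)
  have notin: "y a \<notin> convex hull (y ` K)" if "a \<notin> K" for a K
    using realisation_notin_hull[OF q, of "\<sigma> a" "\<sigma> ` K"] that \<open>inj \<sigma>\<close>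
    by (auto simp: y_def image_image inj_image_mem_iff)
  have T_add: "T (x + x', 2) = T (x, 1) + T (x', 1)" for x x'
    using linear_add[OF T(1), of "(x, 1)" "(x', 1)"] by simp
  have T_sum: "T (\<Sum>k\<in>UNIV. (2 * w k) *\<^sub>R x k, 2) = (\<Sum>k\<in>UNIV. (2 * w k) *\<^sub>R T (x k, 1))"
    if "sum w UNIV = 1" for w and x :: "4 \<Rightarrow> real^4"
  proof -
    have "(\<Sum>k\<in>UNIV. (2 * w k) *\<^sub>R x k, 2) = (\<Sum>k\<in>UNIV. (2 * w k) *\<^sub>R (x k, 1::real))"
      using that by (simp add: prod_eq_iff fst_sum snd_sum flip: sum_distrib_left)
    then show ?thesis by (simp only: linear_sum[OF T(1)] linear_scale[OF T(1)])
  qed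
  \<comment> \<open>With the factor of one corner gone, the parallelogram relation puts the opposite
    lifted corner into the cone over the other two.\<close>
  have square: "l (V i' j') = 0 \<and> l (V i j') = 0 \<and> l (V i' j) = 0"
    if "l (V i j) = 0" "i \<noteq> i'" "j \<noteq> j'" for i j i' j'
  proof -
    have "T (vert c (V i j), 1) + T (vert c (V i' j'), 1) = T (vert c (V i j'), 1) + T (vert c (V i' j), 1)"
      unfolding T_add[symmetric] vert_parallelogram ..
    then have eq: "l (V i' j') *\<^sub>R (y (V i' j'), 1::real) = (\<Sum>k\<in>{V i j', V i' j}. l k *\<^sub>R (y k, 1))"
      using that unfolding Ty by (simp del: scaleR_Pair add_Pair)
    have "y (V i' j') \<notin> convex hull (y ` {V i j', V i' j})"
      using that by (intro notin) auto
    note zero = lifted_hull_zero[OF eq _ l(1) this]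
    have "l (V i' j') = 0" by (rule zero(1)) simp
    moreover have "l (V i j') = 0" "l (V i' j) = 0" by (rule zero(2); simp)+
    ultimately show ?thesis by simp
  qed
  have V_all: "l (V i' j') = 0" if "l (V i j) = 0" for i j i' j'
  proof -
    have ne: "i \<noteq> i + 1" "j \<noteq> j + 1" by simp_all
    show ?thesis
      using square[OF that ne] square[OF that ne(1), of j'] square[OF that _ ne(2), of i']
        square[OF that, of i' j'] that by metis
  qed
  have c1: "\<bar>c$k\<bar> < 1" for k using c by (simp add: unit_box_def)
  have V'_eq: "l (V' (i - 1)) *\<^sub>R (y (V' (i - 1)), 1::real) + l (V' i) *\<^sub>R (y (V' i), 1)
      = (\<Sum>j\<in>UNIV. (2 * weight (c$3) (c$4) j * l (V i j)) *\<^sub>R (y (V i j), 1))" for i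
  proof -
    have "T (vert c (V' (i - 1)), 1) + T (vert c (V' i), 1)
      = (\<Sum>j\<in>UNIV. (2 * weight (c$3) (c$4) j) *\<^sub>R T (vert c (V i j), 1))"
      unfolding T_add[symmetric] vert_centre(1) T_sum[OF vert_centre(3)] ..
    then show ?thesis unfolding Ty scaleR_scaleR .
  qed
  have V''_eq: "l (V'' (j - 1)) *\<^sub>R (y (V'' (j - 1)), 1::real) + l (V'' j) *\<^sub>R (y (V'' j), 1)
      = (\<Sum>i\<in>UNIV. (2 * weight (c$1) (c$2) i * l (V i j)) *\<^sub>R (y (V i j), 1))" for j
  proof -
    have "T (vert c (V'' (j - 1)), 1) + T (vert c (V'' j), 1)
      = (\<Sum>i\<in>UNIV. (2 * weight (c$1) (c$2) i) *\<^sub>R T (vert c (V i j), 1))"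
      unfolding T_add[symmetric] vert_centre(2) T_sum[OF vert_centre(3)] ..
    then show ?thesis unfolding Ty scaleR_scaleR .
  qed
  \<comment> \<open>Of the two apices of the bipyramid \<open>facet (V' (i + 1))\<close> one has
    factor 0, so the other would lie in the hull of the square base.\<close>
  have V'_V: "l (V (i + 1) j) = 0" if "l (V' i) = 0" for i j
  proof -
    have eq: "l (V' (i + 1)) *\<^sub>R (y (V' (i + 1)), 1::real)
      = (\<Sum>j\<in>UNIV. (2 * weight (c$3) (c$4) j * l (V (i + 1) j)) *\<^sub>R (y (V (i + 1) j), 1))"
      using V'_eq[of "i + 1"] that by simp
    have "y (V' (i + 1)) \<notin> convex hull (y ` range (V (i + 1)))" by (intro notin) auto
    then have "y (V' (i + 1)) \<notin> convex hull range (\<lambda>j. y (V (i + 1) j))" by (simp add: image_image)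
    from lifted_hull_zero(2)[OF eq _ _ this, of j] show ?thesis
      using weight_pos[OF c1 c1, of 3 4] l(1) by (simp add: less_imp_le less_imp_neq[symmetric])
  qed
  have V''_V: "l (V i (j + 1)) = 0" if "l (V'' j) = 0" for i j
  proof -
    have eq: "l (V'' (j + 1)) *\<^sub>R (y (V'' (j + 1)), 1::real)
      = (\<Sum>i\<in>UNIV. (2 * weight (c$1) (c$2) i * l (V i (j + 1))) *\<^sub>R (y (V i (j + 1)), 1))"
      using V''_eq[of "j + 1"] that by simp
    have "y (V'' (j + 1)) \<notin> convex hull (y ` range (\<lambda>i. V i (j + 1)))" by (intro notin) auto
    then have "y (V'' (j + 1)) \<notin> convex hull range (\<lambda>i. y (V i (j + 1)))" by (simp add: image_image)
    from lifted_hull_zero(2)[OF eq _ _ this, of i] show ?thesis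
      using weight_pos[OF c1 c1, of 1 2] l(1) by (simp add: less_imp_le less_imp_neq[symmetric])
  qed
  have V0: "l (V i j) = 0" for i j
  proof (cases v)
    case (V i' j') then show ?thesis using lv V_all by metis
  next
    case (V' i') then show ?thesis using lv V_all V'_V by metis
  next
    case (V'' i') then show ?thesis using lv V_all V''_V by metis
  qed
  have V'0: "l (V' i) = 0" for i
  proof -
    have "l (V' (i - 1)) + l (V' i) = 0"
      using arg_cong[OF V'_eq[of i], of snd] V0 by (simp add: snd_sum)
    then show ?thesis using l(1)[of "V' (i - 1)"] l(1)[of "V' i"] by linarith
  qed
  have V''0: "l (V'' j) = 0" for j
  proof -
    have "l (V'' (j - 1)) + l (V'' j) = 0"
      using arg_cong[OF V''_eq[of j], of snd] V0 by (simp add: snd_sum)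
    then show ?thesis using l(1)[of "V'' (j - 1)"] l(1)[of "V'' j"] by linarith
  qed
  have "l w = 0" for w using V0 V'0 V''0 by (cases w) auto
  then have "(vert c w, 1) \<in> {x. T x = 0}" for w by (simp add: Ty zero_prod_def)
  moreover have "subspace {x. T x = 0}" using T(1) by (rule linear_subspace_kernel)
  ultimately have "{x. T x = 0} = UNIV" by (intro subspace_lift_UNIV[OF affine_hull_vert[OF c]])
  then show False using T(2) by auto
qed

text \<open>The normalised maps lie on a compact sphere, so a subsequence converges to a nonzero
  linear map. Its factors are limits of positive numbers, hence only nonnegative;
  \<open>labelled_limit_positive\<close> excludes zero.\<close>

lemma labelled_closed:
  fixes q :: "nat \<Rightarrow> (real^4)^e44_vertex"
  assumes lim: "c \<longlonglongrightarrow> a" "q \<longlonglongrightarrow> b"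
    and a: "a \<in> unit_box" and b: "b \<in> realisation_space E44" and "inj \<sigma>"
    and eq: "\<And>n. labelled_equivalent \<sigma> (vert (c n)) (vec_nth (q n))"
  shows "labelled_equivalent \<sigma> (vert a) (vec_nth b)"
proof -
  have "\<forall>n. \<exists>T :: ((real^4) \<times> real) \<Rightarrow>\<^sub>L ((real^4) \<times> real). norm T = 1 \<and>
     (\<forall>v. \<exists>l>0. blinfun_apply T (vert (c n) v, 1) = l *\<^sub>R (q n $ \<sigma> v, 1))"
    using eq unfolding labelled_equivalent_def by blast
  then obtain T :: "nat \<Rightarrow> ((real^4) \<times> real) \<Rightarrow>\<^sub>L ((real^4) \<times> real)" where
    T: "\<And>n. norm (T n) = 1" "\<And>n v. \<exists>l>0. blinfun_apply (T n) (vert (c n) v, 1) = l *\<^sub>R (q n $ \<sigma> v, 1)"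
    by metis
  have "compact (sphere (0 :: ((real^4) \<times> real) \<Rightarrow>\<^sub>L ((real^4) \<times> real)) 1)"
    unfolding compact_eq_bounded_closed
  proof
    show "bounded (sphere (0 :: ((real^4) \<times> real) \<Rightarrow>\<^sub>L ((real^4) \<times> real)) 1)"
      by (rule bounded_subset[OF bounded_cball sphere_cball])
    have "sphere (0 :: ((real^4) \<times> real) \<Rightarrow>\<^sub>L ((real^4) \<times> real)) 1 = norm -` {1}" by auto
    then show "closed (sphere (0 :: ((real^4) \<times> real) \<Rightarrow>\<^sub>L ((real^4) \<times> real)) 1)"
      by (simp add: closed_vimage continuous_on_norm_id)
  qed
  moreover have "T n \<in> sphere 0 1" for n using T(1) by simp
  ultimately obtain S r where S: "S \<in> sphere 0 1" "strict_mono r" "(T \<circ> r) \<longlonglongrightarrow> S"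
    unfolding compact_eq_seq_compact_metric seq_compact_def by meson
  have lim_r: "(\<lambda>n. c (r n)) \<longlonglongrightarrow> a" "(\<lambda>n. q (r n)) \<longlonglongrightarrow> b"
    using LIMSEQ_subseq_LIMSEQ[OF lim(1) S(2)] LIMSEQ_subseq_LIMSEQ[OF lim(2) S(2)] by (simp_all add: o_def)
  have lim_T: "(\<lambda>n. blinfun_apply (T (r n)) (vert (c (r n)) v, 1)) \<longlonglongrightarrow> blinfun_apply S (vert a v, 1)" for v
    using S(3) lim_r(1) by (intro blinfun.tendsto tendsto_Pair tendsto_vert) (simp_all add: o_def)
  \<comment> \<open>The lifted targets have last coordinate 1, so the factor can be read off as the
    last coordinate of the image.\<close>
  define l where "l v = snd (blinfun_apply S (vert a v, 1))" for v
  have lim_l: "(\<lambda>n. snd (blinfun_apply (T (r n)) (vert (c (r n)) v, 1))) \<longlonglongrightarrow> l v" for v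
    unfolding l_def by (intro tendsto_snd lim_T)
  have T_snd: "blinfun_apply (T n) (vert (c n) v, 1) = snd (blinfun_apply (T n) (vert (c n) v, 1)) *\<^sub>R (q n $ \<sigma> v, 1)"
    "0 \<le> snd (blinfun_apply (T n) (vert (c n) v, 1))" for n v
    using T(2)[of n v] by auto
  have nonneg: "0 \<le> l v" for v
    using lim_l T_snd(2) by (intro LIMSEQ_le_const[OF lim_l]) blast
  have Sl: "blinfun_apply S (vert a v, 1) = l v *\<^sub>R (b $ \<sigma> v, 1)" for v
  proof (rule LIMSEQ_unique[OF lim_T])
    have "(\<lambda>n. snd (blinfun_apply (T (r n)) (vert (c (r n)) v, 1)) *\<^sub>R (q (r n) $ \<sigma> v, 1::real))
       \<longlonglongrightarrow> l v *\<^sub>R (b $ \<sigma> v, 1)"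
      by (intro tendsto_scaleR lim_l tendsto_Pair tendsto_vec_nth lim_r tendsto_const)
    then show "(\<lambda>n. blinfun_apply (T (r n)) (vert (c (r n)) v, 1)) \<longlonglongrightarrow> l v *\<^sub>R (b $ \<sigma> v, 1)"
      unfolding T_snd(1)[symmetric] .
  qed
  have "S \<noteq> 0" using S(1) by auto
  then obtain z where z: "blinfun_apply S z \<noteq> 0" by (metis blinfun_eqI zero_blinfun.rep_eq)
  have "l v > 0" for v
    by (rule labelled_limit_positive[OF a b \<open>inj \<sigma>\<close> bounded_linear.linear[OF blinfun.bounded_linear_right] z nonneg Sl])
  then show ?thesis
    unfolding labelled_equivalent_def using S(1) Sl by (intro exI[of _ S]) auto
qed

section \<open>Rigidity\<close>

text \<open>\<open>vert c (V i j)\<close> is a vertex of the fixed cube whatever \<open>c\<close>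
  is; the lifted cube vertices span.\<close>

lemma subspace_cube_UNIV:
  assumes "subspace S" "\<And>i j. (vert c (V i j), 1::real) \<in> S"
  shows "S = UNIV"
proof -
  have "convex {x. (x, 1) \<in> S}"
  proof (rule convexI)
    fix x y :: "real^4" and u v :: real
    assume *: "x \<in> {x. (x, 1) \<in> S}" "y \<in> {x. (x, 1) \<in> S}" "u + v = 1"
    have "u *\<^sub>R (x, 1) + v *\<^sub>R (y, 1) \<in> S"
      using * by (intro subspace_add subspace_scale assms(1)) simp_all
    then show "u *\<^sub>R x + v *\<^sub>R y \<in> {x. (x, 1) \<in> S}" using *(3) by simp
  qed
  then have cube: "(x, 1) \<in> S" if "\<And>k. \<bar>x$k\<bar> \<le> 1" for x
    using cube_subset_convex[of "{x. (x, 1) \<in> S}"] assms(2) that by simp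
  have "(x, t) \<in> S" for x t
  proof -
    define N where "N = 1 + norm x"
    have "N > 0" by (simp add: N_def add_pos_nonneg)
    have "\<bar>((1 / N) *\<^sub>R x)$k\<bar> \<le> 1" for k
      using component_le_norm_cart[of x k] \<open>N > 0\<close> by (simp add: N_def abs_divide)
    then have "((1 / N) *\<^sub>R x, 1) \<in> S" by (rule cube)
    moreover have "(0, 1) \<in> S" by (rule cube) simp
    ultimately have "N *\<^sub>R ((1 / N) *\<^sub>R x, 1) + (t - N) *\<^sub>R (0, 1) \<in> S"
      by (intro subspace_add subspace_scale assms(1))
    then show ?thesis using \<open>N > 0\<close> by simp
  qed
  then show ?thesis by auto
qed

text \<open>The unknown factors \<open>m\<close> are pinned down on the cube by its parallelograms.
  Once they agree there, \<open>S\<close> is a scalar on a spanning set, hence everywhere, and the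
  apices are fixed too.\<close>

lemma vert_projectively_rigid:
  fixes S :: "(real^4) \<times> real \<Rightarrow> (real^4) \<times> real"
  assumes S: "linear S" and m: "\<And>w. m w > 0" "\<And>w. S (vert c w, 1) = m w *\<^sub>R (vert d w, 1::real)"
  shows "c = d"
proof -
  have S_add: "S (x + x', 2) = S (x, 1) + S (x', 1)" for x x'
    using linear_add[OF S, of "(x, 1)" "(x', 1)"] by simp
  have "m (V i j) *\<^sub>R (vert d (V i j), 1::real) + m (V i' j') *\<^sub>R (vert d (V i' j'), 1)
      = m (V i j') *\<^sub>R (vert d (V i j'), 1) + m (V i' j) *\<^sub>R (vert d (V i' j), 1)" for i j i' j'
    unfolding m(2)[symmetric] S_add[symmetric] vert_parallelogram ..
  then have rel: "m (V i j) *\<^sub>R vert d (V i j) + m (V i' j') *\<^sub>R vert d (V i' j')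
      = m (V i j') *\<^sub>R vert d (V i j') + m (V i' j) *\<^sub>R vert d (V i' j)"
     "m (V i j) + m (V i' j') = m (V i j') + m (V i' j)" for i j i' j'
    by auto
  have sx2: "sx (k + 2) = - sx k" "sx k \<noteq> 0" for k
  proof -
    have "\<forall>k. sx (k + 2) = - sx k \<and> sx k \<noteq> 0" unfolding forall_Z4 by (simp add: sx_def)
    then show "sx (k + 2) = - sx k" "sx k \<noteq> 0" by blast+
  qed
  \<comment> \<open>Coordinate 1 changes sign from \<open>i\<close> to \<open>i + 2\<close>: it
    gives the relation with differences of factors, the lifting coordinate the one with sums, and
    adding the two isolates the claim.\<close>
  have "m (V i j) = m (V i j')" for i j j'
  proof -
    have "m (V i j) * sx i - m (V (i + 2) j') * sx i = m (V i j') * sx i - m (V (i + 2) j) * sx i"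
      using arg_cong[OF rel(1)[of i j "i + 2" j'], of "\<lambda>x. x$1"] sx2 by simp
    then have "(m (V i j) - m (V (i + 2) j')) * sx i = (m (V i j') - m (V (i + 2) j)) * sx i"
      by (simp add: left_diff_distrib)
    then have "m (V i j) - m (V (i + 2) j') = m (V i j') - m (V (i + 2) j)" using sx2 by simp
    then show ?thesis using rel(2)[of i j "i + 2" j'] by simp
  qed
  moreover have "m (V i j) = m (V i' j)" for i j i'
  proof -
    have "m (V i j) * sx j - m (V i' (j + 2)) * sx j = m (V i' j) * sx j - m (V i (j + 2)) * sx j"
      using arg_cong[OF rel(1)[of i j i' "j + 2"], of "\<lambda>x. x$3"] sx2 by simp
    then have "(m (V i j) - m (V i' (j + 2))) * sx j = (m (V i' j) - m (V i (j + 2))) * sx j"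
      by (simp add: left_diff_distrib)
    then have "m (V i j) - m (V i' (j + 2)) = m (V i' j) - m (V i (j + 2))" using sx2 by simp
    then show ?thesis using rel(2)[of i j i' "j + 2"] by simp
  qed
  ultimately have "m (V i j) = m (V 0 0)" for i j by metis
  then have "S (vert c (V i j), 1) = m (V 0 0) *\<^sub>R (vert c (V i j), 1)" for i j
    unfolding m(2) by simp
  moreover have "subspace {x. S x = m (V 0 0) *\<^sub>R x}"
    using S by (auto simp: subspace_def linear_0 linear_add linear_scale scaleR_add_right)
  ultimately have "{x. S x = m (V 0 0) *\<^sub>R x} = UNIV"
    by (intro subspace_cube_UNIV[where c = c]) simp_all
  then have "S x = m (V 0 0) *\<^sub>R x" for x by blast
  then have "m w *\<^sub>R (vert d w, 1::real) = m (V 0 0) *\<^sub>R (vert c w, 1)" for w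
    using m(2) by metis
  then have "vert c w = vert d w" for w
    using m(1)[of w] unfolding scaleR_lift_eq_iff by (metis less_irrefl)
  then have "vert c (V' 0) $ k = vert d (V' 0) $ k" "vert c (V' 1) $ k = vert d (V' 1) $ k" for k
    by (simp_all only:)
  \<comment> \<open>The apex \<open>V' 0\<close> shows coordinates 2, 3 and 4 of the base point
    unreflected, the apex \<open>V' 1\<close> coordinate 1.\<close>
  from this(1)[of 2] this(1)[of 3] this(1)[of 4] this(2)[of 1] show ?thesis
    by (simp add: vec_eq_iff forall_4 ax_def ay_def)
qed

text \<open>The second map composed with the inverse of the first takes \<open>vert c\<close> to
  \<open>vert d\<close> label by label with positive factors, so rigidity applies.\<close>

lemma labelled_unique:
  assumes "labelled_equivalent \<sigma> p (vert c)" "labelled_equivalent \<sigma> p (vert d)"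
    and "surj \<sigma>" "c \<in> unit_box"
  shows "c = d"
proof -
  obtain A :: "((real^4) \<times> real) \<Rightarrow>\<^sub>L ((real^4) \<times> real)" where
    A: "\<And>v. \<exists>l>0. blinfun_apply A (p v, 1) = l *\<^sub>R (vert c (\<sigma> v), 1)"
    using assms(1) unfolding labelled_equivalent_def by blast
  obtain B :: "((real^4) \<times> real) \<Rightarrow>\<^sub>L ((real^4) \<times> real)" where
    B: "\<And>v. \<exists>l>0. blinfun_apply B (p v, 1) = l *\<^sub>R (vert d (\<sigma> v), 1)"
    using assms(2) unfolding labelled_equivalent_def by blast
  have lin: "linear (blinfun_apply C)" for C :: "((real^4) \<times> real) \<Rightarrow>\<^sub>L ((real^4) \<times> real)"
    by (rule bounded_linear.linear[OF blinfun.bounded_linear_right])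
  have bij: "bij (blinfun_apply A)"
    by (rule bij_of_labelled[OF lin A \<open>surj \<sigma>\<close> affine_hull_vert[OF assms(4)]])
  define S where "S = blinfun_apply B \<circ> inv_into UNIV (blinfun_apply A)"
  have inv: "linear (inv_into UNIV (blinfun_apply A))"
    by (rule inj_linear_imp_inv_linear[OF lin bij_is_inj[OF bij]])
  then have "linear S" unfolding S_def by (intro linear_compose lin)
  have "\<exists>m>0. S (vert c w, 1) = m *\<^sub>R (vert d w, 1)" for w
  proof -
    obtain v where v: "w = \<sigma> v" using surjD[OF \<open>surj \<sigma>\<close>] by blast
    obtain l where l: "l > 0" "blinfun_apply A (p v, 1) = l *\<^sub>R (vert c w, 1)" using A v by blast
    obtain k where k: "k > 0" "blinfun_apply B (p v, 1) = k *\<^sub>R (vert d w, 1)" using B v by blast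
    have "(vert c w, 1) = (1 / l) *\<^sub>R blinfun_apply A (p v, 1)" unfolding l(2) using l(1) by simp
    then have "inv_into UNIV (blinfun_apply A) (vert c w, 1) = (1 / l) *\<^sub>R inv_into UNIV (blinfun_apply A) (blinfun_apply A (p v, 1))"
      by (simp only: linear_scale[OF inv])
    also have "\<dots> = (1 / l) *\<^sub>R (p v, 1)" by (simp only: inv_f_f[OF bij_is_inj[OF bij]])
    finally have "S (vert c w, 1) = (1 / l) *\<^sub>R (k *\<^sub>R (vert d w, 1))"
      unfolding S_def o_def k(2)[symmetric] by (simp only: linear_scale[OF lin])
    then show ?thesis using l(1) k(1) by (intro exI[of _ "k / l"]) simp
  qed
  then obtain m where "\<And>w. m w > 0" "\<And>w. S (vert c w, 1) = m w *\<^sub>R (vert d w, 1)" by metis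
  then show ?thesis by (rule vert_projectively_rigid[OF \<open>linear S\<close>])
qed

text \<open>Given \<open>i\<close>, either \<open>R i\<close> holds on the diagonal of the current open set and is the identity there
  by uniqueness, or some \<open>(a, a)\<close> violates it and by closedness \<open>R i\<close> is empty near \<open>(a, a)\<close>.\<close>

lemma open_subset_without_relations:
  fixes R :: "'i \<Rightarrow> 'a::metric_space \<Rightarrow> 'a \<Rightarrow> bool"
  assumes "finite I" "open U" "U \<noteq> {}"
    and closed: "\<And>i x y a. i \<in> I \<Longrightarrow> (\<And>n. R i (x n) (y n)) \<Longrightarrow> x \<longlonglongrightarrow> a \<Longrightarrow> y \<longlonglongrightarrow> a \<Longrightarrow> a \<in> U \<Longrightarrow> R i a a"
    and unique: "\<And>i a b. i \<in> I \<Longrightarrow> a \<in> U \<Longrightarrow> R i a a \<Longrightarrow> R i a b \<Longrightarrow> a = b"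
  shows "\<exists>W. open W \<and> W \<noteq> {} \<and> W \<subseteq> U \<and> (\<forall>i\<in>I. \<forall>x\<in>W. \<forall>y\<in>W. R i x y \<longrightarrow> x = y)"
  using assms(1) closed unique
proof (induction I rule: finite_induct)
  case empty
  then show ?case using assms(2,3) by (intro exI[of _ U]) simp
next
  case (insert i I)
  have "\<exists>W. open W \<and> W \<noteq> {} \<and> W \<subseteq> U \<and> (\<forall>i\<in>I. \<forall>x\<in>W. \<forall>y\<in>W. R i x y \<longrightarrow> x = y)"
    by (rule insert.IH) (use insert.prems in blast)+
  then obtain W where W: "open W" "W \<noteq> {}" "W \<subseteq> U" "\<forall>i\<in>I. \<forall>x\<in>W. \<forall>y\<in>W. R i x y \<longrightarrow> x = y"
    by (elim exE conjE)
  show ?case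
  proof (cases "\<forall>a\<in>W. R i a a")
    case True
    then have "\<forall>x\<in>W. \<forall>y\<in>W. R i x y \<longrightarrow> x = y"
      using insert.prems(2)[of i] W(3) by blast
    then show ?thesis using W by (intro exI[of _ W]) simp
  next
    case False
    then obtain a where a: "a \<in> W" "\<not> R i a a" by blast
    obtain e where e: "e > 0" "ball a e \<subseteq> W" using a(1) W(1) by (meson openE)
    have "\<exists>d>0. \<forall>x\<in>ball a d. \<forall>y\<in>ball a d. \<not> R i x y"
    proof (rule ccontr)
      assume none: "\<not> (\<exists>d>0. \<forall>x\<in>ball a d. \<forall>y\<in>ball a d. \<not> R i x y)"
      have "\<forall>n. \<exists>x y. dist a x < inverse (real (Suc n)) \<and> dist a y < inverse (real (Suc n)) \<and> R i x y"
      proof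
        fix n
        have "inverse (real (Suc n)) > 0" by simp
        then show "\<exists>x y. dist a x < inverse (real (Suc n)) \<and> dist a y < inverse (real (Suc n)) \<and> R i x y"
          using none unfolding mem_ball[symmetric] by blast
      qed
      then obtain x y where xy: "\<And>n. dist a (x n) < inverse (real (Suc n))"
        "\<And>n. dist a (y n) < inverse (real (Suc n))" "\<And>n. R i (x n) (y n)" by metis
      have lim: "z \<longlonglongrightarrow> a" if "\<And>n. dist a (z n) < inverse (real (Suc n))" for z
      proof (rule metric_tendsto_imp_tendsto[OF LIMSEQ_inverse_real_of_nat])
        show "\<forall>\<^sub>F n in sequentially. dist (z n) a \<le> dist (inverse (real (Suc n))) 0"
          using that by (intro always_eventually allI) (simp add: dist_commute less_imp_le)
      qed
      have "R i a a"
        using insert.prems(1)[of i x y a] xy lim a(1) W(3) by blast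
      then show False using a(2) by blast
    qed
    then obtain d where d: "d > 0" "\<forall>x\<in>ball a d. \<forall>y\<in>ball a d. \<not> R i x y" by blast
    have "open (ball a (min d e))" "ball a (min d e) \<noteq> {}" "ball a (min d e) \<subseteq> U"
      "\<forall>k\<in>insert i I. \<forall>x\<in>ball a (min d e). \<forall>y\<in>ball a (min d e). R k x y \<longrightarrow> x = y"
      using d e W(3,4) by (auto simp: subset_eq)
    then show ?thesis by blast
  qed
qed

section \<open>A ball of pairwise inequivalent members\<close>

abbreviation vert_tuple :: "real^4 \<Rightarrow> (real^4)^e44_vertex" where
  "vert_tuple c \<equiv> \<chi> v. vert c v"

lemma vec_nth_vert_tuple [simp]: "vec_nth (vert_tuple c) = vert c"
  by (simp add: vec_lambda_inverse)

lemma tendsto_vert_tuple: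
  assumes "(f \<longlongrightarrow> a) F"
  shows "((\<lambda>x. vert_tuple (f x)) \<longlongrightarrow> vert_tuple a) F"
  by (rule vec_tendstoI) (simp add: tendsto_vert[OF assms])

lemma open_unit_box: "open unit_box"
proof -
  have box: "unit_box = box (-1) 1"
    by (auto simp: unit_box_def mem_box_cart abs_less_iff)
  show ?thesis unfolding box by (rule open_box)
qed

lemma realisation_equivalent_imp_labelled:
  fixes p q :: "(real^4)^e44_vertex"
  assumes "projectively_equivalent (convex hull (range (vec_nth p))) (convex hull (range (vec_nth q)))"
    and "q \<in> realisation_space E44"
  shows "\<exists>\<sigma>. bij \<sigma> \<and> labelled_equivalent \<sigma> (vec_nth p) (vec_nth q)"
  using assms realisation_inj realisation_extreme by (intro projectively_equivalent_imp_labelled) auto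

lemma ball_of_inequivalent_vert:
  "\<exists>a r. r > 0 \<and> cball a r \<subseteq> unit_box \<and> (\<forall>c\<in>cball a r. \<forall>d\<in>cball a r.
     projectively_equivalent (convex hull (range (vert c))) (convex hull (range (vert d))) \<longrightarrow> c = d)"
proof -
  define R where "R \<sigma> c d \<longleftrightarrow> labelled_equivalent \<sigma> (vert c) (vert d)" for \<sigma> c d
  have "\<exists>W. open W \<and> W \<noteq> {} \<and> W \<subseteq> unit_box \<and> (\<forall>\<sigma>\<in>{\<sigma>. bij \<sigma>}. \<forall>x\<in>W. \<forall>y\<in>W. R \<sigma> x y \<longrightarrow> x = y)"
  proof (rule open_subset_without_relations)
    show "unit_box \<noteq> {}" by (auto simp: unit_box_def intro!: exI[of _ 0])
    show "finite {\<sigma> :: e44_vertex \<Rightarrow> e44_vertex. bij \<sigma>}" by (rule finite)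
    show "open unit_box" by (rule open_unit_box)
    fix \<sigma> :: "e44_vertex \<Rightarrow> e44_vertex"
    assume \<sigma>: "\<sigma> \<in> {\<sigma>. bij \<sigma>}"
    show "R \<sigma> a a" if R: "\<And>n. R \<sigma> (x n) (y n)" and lim: "x \<longlonglongrightarrow> a" "y \<longlonglongrightarrow> a" and "a \<in> unit_box" for x y a
      using labelled_closed[OF lim(1) tendsto_vert_tuple[OF lim(2)] \<open>a \<in> unit_box\<close>
          vert_tuple_realisation[OF \<open>a \<in> unit_box\<close>], of \<sigma>] R \<sigma>
      by (simp add: R_def bij_is_inj)
    show "a = b" if "a \<in> unit_box" "R \<sigma> a a" "R \<sigma> a b" for a b
      using labelled_unique[of \<sigma> "vert a" a b] that \<sigma> by (simp add: R_def bij_is_surj)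
  qed
  then obtain W where W: "open W" "W \<noteq> {}" "W \<subseteq> unit_box"
    "\<And>\<sigma> x y. bij \<sigma> \<Longrightarrow> x \<in> W \<Longrightarrow> y \<in> W \<Longrightarrow> R \<sigma> x y \<Longrightarrow> x = y" by blast
  obtain a where "a \<in> W" using W(2) by blast
  then obtain r where r: "r > 0" "cball a r \<subseteq> W" using W(1) open_contains_cball by metis
  show ?thesis
  proof (intro exI conjI ballI impI)
    show "0 < r" by (rule r(1))
    show "cball a r \<subseteq> unit_box" using r W by blast
    fix c d assume cd: "c \<in> cball a r" "d \<in> cball a r"
      "projectively_equivalent (convex hull (range (vert c))) (convex hull (range (vert d)))"
    then have "vert_tuple d \<in> realisation_space E44" using r W vert_tuple_realisation by blast
    then obtain \<sigma> where "bij \<sigma>" "R \<sigma> c d"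
      using realisation_equivalent_imp_labelled[of "vert_tuple c" "vert_tuple d"] cd(3) unfolding R_def by auto
    then show "c = d" using W(4) cd r by blast
  qed
qed

section \<open>Embedding a ball into the projective realisation space\<close>

lemma equiv_projective_rel: "equiv (realisation_space L) (projective_rel L :: ((real^'d)^'v::finite) rel)"
proof (rule equivI)
  show "projective_rel L \<subseteq> realisation_space L \<times> (realisation_space L :: ((real^'d)^'v::finite) set)"
    by (auto simp: projective_rel_def)
  show "refl_on (realisation_space L) (projective_rel L :: ((real^'d)^'v::finite) rel)"
    by (auto simp: refl_on_def projective_rel_def projectively_equivalent_refl)
  show "sym (projective_rel L :: ((real^'d)^'v::finite) rel)"
    by (auto simp: sym_def projective_rel_def intro: projectively_equivalent_sym)
  show "trans (projective_rel L :: ((real^'d)^'v::finite) rel)"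
    unfolding trans_def projective_rel_def using projectively_equivalent_trans by blast
qed

text \<open>A set of classes is closed in the quotient when their union is closed in the realisation
  space; this is that union for base points in \<open>K\<close>. Along a convergent sequence the
  relabelling may vary, but one of the finitely many bijections recurs infinitely often, and on that
  subsequence compactness of \<open>K\<close> and \<open>labelled_closed\<close> apply.\<close>

lemma closedin_saturation:
  assumes K: "compact K" "K \<subseteq> unit_box"
  shows "closedin (top_of_set (realisation_space E44)) {q. \<exists>c\<in>K. (vert_tuple c, q) \<in> projective_rel E44}"
    (is "closedin _ ?S")
  unfolding closedin_limpt
proof (intro conjI allI impI)
  show "?S \<subseteq> realisation_space E44" by (auto simp: projective_rel_def)
  fix b assume b: "b islimpt ?S \<and> b \<in> realisation_space E44"
  then obtain q where q: "\<And>n. q n \<in> ?S" "q \<longlonglongrightarrow> b" unfolding islimpt_sequential by blast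
  then have "\<forall>n. \<exists>c\<in>K. (vert_tuple c, q n) \<in> projective_rel E44" by blast
  then obtain c where c: "\<And>n. c n \<in> K" "\<And>n. (vert_tuple (c n), q n) \<in> projective_rel E44" by metis
  have "\<exists>\<sigma>. bij \<sigma> \<and> labelled_equivalent \<sigma> (vert (c n)) (vec_nth (q n))" for n
    using realisation_equivalent_imp_labelled[of "vert_tuple (c n)" "q n"] c(2)[of n]
    unfolding projective_rel_def by simp
  then obtain \<sigma> where \<sigma>: "\<And>n. bij (\<sigma> n)" "\<And>n. labelled_equivalent (\<sigma> n) (vert (c n)) (vec_nth (q n))"
    by metis
  have "\<exists>m\<in>UNIV. infinite {n\<in>UNIV. \<sigma> n = \<sigma> m}" by (rule pigeonhole_infinite) auto
  then obtain m where "infinite {n. \<sigma> n = \<sigma> m}" by auto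
  from infinite_enumerate[OF this] obtain r :: "nat \<Rightarrow> nat" where r: "strict_mono r" "\<forall>n. r n \<in> {n. \<sigma> n = \<sigma> m}"
    by (elim exE conjE)
  have "\<forall>n. (c \<circ> r) n \<in> K" using c by simp
  then obtain a s where a: "a \<in> K" "strict_mono s" "((c \<circ> r) \<circ> s) \<longlonglongrightarrow> a"
    using K(1) unfolding compact_eq_seq_compact_metric seq_compact_def by meson
  have "(q \<circ> (r \<circ> s)) \<longlonglongrightarrow> b" using q(2) r(1) a(2) by (intro LIMSEQ_subseq_LIMSEQ strict_mono_o)
  have lab: "labelled_equivalent (\<sigma> m) (vert a) (vec_nth b)"
  proof (rule labelled_closed[OF a(3) \<open>(q \<circ> (r \<circ> s)) \<longlonglongrightarrow> b\<close>])
    show "labelled_equivalent (\<sigma> m) (vert (((c \<circ> r) \<circ> s) n)) (vec_nth ((q \<circ> (r \<circ> s)) n))" for n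
      using \<sigma>(2)[of "r (s n)"] r(2) by simp
  qed (use a(1) K(2) b \<sigma>(1) in \<open>auto simp: bij_is_inj\<close>)
  have "projectively_equivalent (convex hull (range (vert a))) (convex hull (range (vec_nth b)))"
    using labelled_imp_projectively_equivalent[OF lab bij_is_surj[OF \<sigma>(1)]] b realisation_affine_hull by blast
  then have "(vert_tuple a, b) \<in> projective_rel E44"
    using b a(1) K(2) vert_tuple_realisation by (auto simp: projective_rel_def)
  then show "b \<in> ?S" using a(1) by blast
qed

text \<open>A closed subset of \<open>K\<close> is again compact, so
  \<open>closedin_saturation\<close> applies to it and makes the map to the quotient closed.\<close>

lemma embedding_projective_classes:
  assumes K: "compact K" "K \<subseteq> unit_box"
    and inj: "\<And>c d. c \<in> K \<Longrightarrow> d \<in> K \<Longrightarrow>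
       projectively_equivalent (convex hull (range (vert c))) (convex hull (range (vert d))) \<Longrightarrow> c = d"
  shows "embedding_map (top_of_set K) (projective_realisation_space E44) (\<lambda>c. projective_rel E44 `` {vert_tuple c})"
proof (rule injective_closed_imp_embedding_map)
  let ?R = "realisation_space E44 :: ((real^4)^e44_vertex) set"
  let ?X = "projective_realisation_space E44 :: ((real^4)^e44_vertex) set topology"
  let ?g = "\<lambda>c. projective_rel E44 `` {vert_tuple c}"
  have tuple_R: "vert_tuple c \<in> ?R" if "c \<in> K" for c using that K(2) vert_tuple_realisation by blast
  have quotient: "quotient_map (top_of_set ?R) ?X (\<lambda>p. projective_rel E44 `` {p})"
    unfolding projective_realisation_space_def by (rule quotient_map_quotient_topology)
  have class_eq: "projective_rel E44 `` {p} = projective_rel E44 `` {q} \<longleftrightarrow> (p, q) \<in> projective_rel E44"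
    if "p \<in> ?R" "q \<in> ?R" for p q :: "(real^4)^e44_vertex"
    using eq_equiv_class_iff[OF equiv_projective_rel that] .
  have "continuous_on K vert_tuple"
    unfolding continuous_on_def by (intro ballI tendsto_vert_tuple tendsto_ident_at)
  then have "continuous_map (top_of_set K) (top_of_set ?R) vert_tuple"
    using tuple_R by auto
  from continuous_map_compose[OF this quotient_imp_continuous_map[OF quotient]]
  show "continuous_map (top_of_set K) ?X ?g" by (simp add: o_def)
  show "inj_on ?g (topspace (top_of_set K))"
  proof (rule inj_onI)
    fix c d assume cd: "c \<in> topspace (top_of_set K)" "d \<in> topspace (top_of_set K)" "?g c = ?g d"
    then have "(vert_tuple c, vert_tuple d) \<in> projective_rel E44" using class_eq tuple_R by simp
    then show "c = d" using inj cd unfolding projective_rel_def by simp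
  qed
  show "closed_map (top_of_set K) ?X ?g"
    unfolding closed_map_def
  proof (intro allI impI)
    fix C assume "closedin (top_of_set K) C"
    then have C: "compact C" "C \<subseteq> K" using K(1) by (auto simp: closedin_compact closedin_subset dest: closedin_imp_subset)
    have "?g ` C \<subseteq> topspace ?X"
      using C(2) tuple_R by (auto simp: projective_realisation_space_def topspace_quotient_topology)
    moreover have "{p \<in> topspace (top_of_set ?R). projective_rel E44 `` {p} \<in> ?g ` C}
        = {q. \<exists>c\<in>C. (vert_tuple c, q) \<in> projective_rel E44}"
    proof (intro equalityI subsetI)
      fix p assume "p \<in> {p \<in> topspace (top_of_set ?R). projective_rel E44 `` {p} \<in> ?g ` C}"
      then obtain c where "c \<in> C" "p \<in> ?R" "?g c = projective_rel E44 `` {p}" by auto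
      then show "p \<in> {q. \<exists>c\<in>C. (vert_tuple c, q) \<in> projective_rel E44}"
        using class_eq[of "vert_tuple c" p] tuple_R C(2) by blast
    next
      fix p assume "p \<in> {q. \<exists>c\<in>C. (vert_tuple c, q) \<in> projective_rel E44}"
      then obtain c where c: "c \<in> C" "(vert_tuple c, p) \<in> projective_rel E44" by blast
      then have "p \<in> ?R" by (simp add: projective_rel_def)
      then show "p \<in> {p \<in> topspace (top_of_set ?R). projective_rel E44 `` {p} \<in> ?g ` C}"
        using c class_eq[of "vert_tuple c" p] tuple_R C(2) by (auto intro!: image_eqI[where x = c])
    qed
    ultimately show "closedin ?X (?g ` C)"
      using closedin_saturation[OF C(1)] C(2) K(2) quotient unfolding quotient_map_closedin by auto
  qed
qed

text \<open>The open ball inside the closed one is a copy of Euclidean space, and the embedding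
  restricts to it.\<close>

lemma cell_dimension_ge:
  fixes a :: "'a::euclidean_space"
  assumes "r > 0" "embedding_map (top_of_set (cball a r)) X g"
  shows "enat DIM('a) \<le> cell_dimension X"
proof -
  obtain f h where "homeomorphic_maps (Euclidean_space DIM('a)) (euclidean :: 'a topology) f h"
    by (rule homeomorphic_maps_Euclidean_space_euclidean)
  then have "Euclidean_space DIM('a) homeomorphic_space (top_of_set (UNIV :: 'a set))"
    unfolding homeomorphic_space_def by auto
  moreover have "(UNIV :: 'a set) homeomorphic ball a r"
  proof (rule homeomorphic_trans)
    show "(UNIV :: 'a set) homeomorphic ball (0 :: 'a) 1"
      by (rule homeomorphic_sym[THEN iffD1, OF homeomorphic_ball01_UNIV])
    show "ball (0 :: 'a) 1 homeomorphic ball a r"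
      using \<open>r > 0\<close> by (intro homeomorphic_balls(1)) simp_all
  qed
  then have "top_of_set (UNIV :: 'a set) homeomorphic_space top_of_set (ball a r)"
    unfolding homeomorphic_space_iff_homeomorphic .
  ultimately have "Euclidean_space DIM('a) homeomorphic_space top_of_set (ball a r)"
    by (rule homeomorphic_space_trans)
  then obtain k where k: "homeomorphic_map (Euclidean_space DIM('a)) (top_of_set (ball a r)) k"
    unfolding homeomorphic_space by blast
  then have "k ` topspace (Euclidean_space DIM('a)) = ball a r"
    using homeomorphic_imp_surjective_map by fastforce
  then have "embedding_map (Euclidean_space DIM('a)) (top_of_set (cball a r)) k"
    unfolding embedding_map_def using k ball_subset_cball[of a r]
    by (simp add: subtopology_subtopology Int_absorb1)
  then have "embedding_map (Euclidean_space DIM('a)) X (g \<circ> k)"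
    using assms(2) by (rule embedding_map_compose)
  then show ?thesis
    unfolding cell_dimension_def by (intro Sup_upper) blast
qed

section \<open>The 24-cell\<close>

lemma inclusion_isomorphic_sym:
  assumes "inclusion_isomorphic L M" shows "inclusion_isomorphic M L"
proof -
  obtain \<phi> where \<phi>: "bij_betw \<phi> L M" "\<forall>F\<in>L. \<forall>G\<in>L. F \<subseteq> G \<longleftrightarrow> \<phi> F \<subseteq> \<phi> G"
    using assms unfolding inclusion_isomorphic_def by (elim exE conjE)
  have "F \<subseteq> G \<longleftrightarrow> inv_into L \<phi> F \<subseteq> inv_into L \<phi> G" if "F \<in> M" "G \<in> M" for F G
  proof -
    have "inv_into L \<phi> F \<in> L" "\<phi> (inv_into L \<phi> F) = F" "inv_into L \<phi> G \<in> L" "\<phi> (inv_into L \<phi> G) = G"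
      using that \<phi>(1) by (simp_all add: bij_betw_def inv_into_into f_inv_into_f)
    then show ?thesis using \<phi>(2) by metis
  qed
  then show ?thesis
    unfolding inclusion_isomorphic_def using bij_betw_inv_into[OF \<phi>(1)]
    by (intro exI[of _ "inv_into L \<phi>"]) simp
qed

lemma inclusion_isomorphic_trans:
  assumes "inclusion_isomorphic L M" "inclusion_isomorphic M N" shows "inclusion_isomorphic L N"
proof -
  obtain \<phi> where \<phi>: "bij_betw \<phi> L M" "\<forall>F\<in>L. \<forall>G\<in>L. F \<subseteq> G \<longleftrightarrow> \<phi> F \<subseteq> \<phi> G"
    using assms(1) unfolding inclusion_isomorphic_def by (elim exE conjE)
  obtain \<psi> where \<psi>: "bij_betw \<psi> M N" "\<forall>F\<in>M. \<forall>G\<in>M. F \<subseteq> G \<longleftrightarrow> \<psi> F \<subseteq> \<psi> G"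
    using assms(2) unfolding inclusion_isomorphic_def by (elim exE conjE)
  have "\<phi> F \<in> M" if "F \<in> L" for F using \<phi>(1) that by (auto simp: bij_betw_def)
  then show ?thesis
    unfolding inclusion_isomorphic_def using bij_betw_trans[OF \<phi>(1) \<psi>(1)] \<phi>(2) \<psi>(2)
    by (intro exI[of _ "\<psi> \<circ> \<phi>"]) simp
qed

lemma inclusion_isomorphic_linear_image:
  fixes A :: "'a::real_vector \<Rightarrow> 'b::real_vector"
  assumes "linear A" "inj A"
  shows "inclusion_isomorphic (face_lattice (A ` P)) (face_lattice P)"
proof (rule inclusion_isomorphic_sym, unfold inclusion_isomorphic_def, intro exI[of _ "image A"] conjI ballI)
  show "F \<subseteq> G \<longleftrightarrow> A ` F \<subseteq> A ` G" for F G using \<open>inj A\<close> by (simp add: inj_image_subset_iff)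
  show "bij_betw (image A) (face_lattice P) (face_lattice (A ` P))"
    unfolding bij_betw_def
  proof
    show "inj_on (image A) (face_lattice P)" using \<open>inj A\<close> by (simp add: inj_on_def inj_image_eq_iff)
    show "image A ` face_lattice P = face_lattice (A ` P)"
    proof (intro equalityI subsetI)
      fix G assume G: "G \<in> face_lattice (A ` P)"
      then have "G \<subseteq> A ` P" by (simp add: face_lattice_def face_of_imp_subset)
      then obtain F where F: "G = A ` F" by (auto simp: subset_image_iff)
      then show "G \<in> image A ` face_lattice P"
        using G face_of_linear_image[OF assms] by (auto simp: face_lattice_def)
    qed (use face_of_linear_image[OF assms] in \<open>auto simp: face_lattice_def\<close>)
  qed
qed

text \<open>A similarity from the 24-cell with vertices \<open>(\<plusminus>1, \<plusminus>1, \<plusminus>1, \<plusminus>1)\<close> and \<open>\<plusminus>2 e\<^sub>k\<close> to the one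
  with vertices the permutations of \<open>(\<plusminus>1, \<plusminus>1, 0, 0)\<close>.\<close>

definition rotate24 :: "real^4 \<Rightarrow> real^4" where
  "rotate24 x = vector [(x$1 + x$2) / 2, (x$1 - x$2) / 2, (x$3 + x$4) / 2, (x$3 - x$4) / 2]"

lemma linear_rotate24: "linear rotate24"
  by (rule linearI) (simp_all add: rotate24_def vec_eq_iff forall_4 field_simps)

lemma inj_rotate24: "inj rotate24"
proof (rule injI)
  fix x y assume "rotate24 x = rotate24 y"
  then have "x$1 + x$2 = y$1 + y$2" "x$1 - x$2 = y$1 - y$2" "x$3 + x$4 = y$3 + y$4" "x$3 - x$4 = y$3 - y$4"
    by (simp_all add: rotate24_def vec_eq_iff forall_4)
  then show "x = y" by (simp add: vec_eq_iff forall_4)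
qed

lemma exists_Z4: "(\<exists>i::4. P i) \<longleftrightarrow> P 0 \<or> P 1 \<or> P 2 \<or> P 3"
  using forall_Z4[of "\<lambda>i. \<not> P i"] by blast

lemma cell24_eq: "cell24 = rotate24 ` (convex hull (range (vert 0)))"
proof -
  have card: "card {i. x$i \<noteq> 0} = (if x$1 \<noteq> 0 then 1 else 0) + (if x$2 \<noteq> 0 then 1 else 0)
      + (if x$3 \<noteq> 0 then 1 else 0) + (if x$4 \<noteq> 0 then 1 else 0)" for x :: "real^4"
  proof -
    have "card {i. x$i \<noteq> 0} = (\<Sum>i\<in>UNIV. if x$i \<noteq> 0 then 1 else 0)"
      by (simp add: sum.If_cases)
    then show ?thesis unfolding sum_4 .
  qed
  have "{x. (\<forall>i. x $ i \<in> {-1, 0, 1}) \<and> card {i. x $ i \<noteq> 0} = 2} = range (\<lambda>v. rotate24 (vert 0 v))"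
  proof (intro equalityI subsetI)
    fix x :: "real^4" assume "x \<in> {x. (\<forall>i. x $ i \<in> {-1, 0, 1}) \<and> card {i. x $ i \<noteq> 0} = 2}"
    then have x: "x$1 \<in> {-1, 0, 1}" "x$2 \<in> {-1, 0, 1}" "x$3 \<in> {-1, 0, 1}" "x$4 \<in> {-1, 0, 1}"
      and "card {i. x$i \<noteq> 0} = 2" by auto
    have mixed: "\<exists>i. a = (sx i + sy i) / 2 \<and> b = (sx i - sy i) / 2"
      if "a \<in> {-1, 0, 1}" "b \<in> {-1, 0, 1}" "a = 0 \<longleftrightarrow> b \<noteq> 0" for a b
      using that unfolding exists_Z4 by (auto simp: sx_def sy_def)
    have both: "\<exists>i. a = (ax i 0 + ay i 0) / 2 \<and> b = (ax i 0 - ay i 0) / 2"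
      if "a \<in> {-1, 0, 1}" "b \<in> {-1, 0, 1}" "a \<noteq> 0" "b \<noteq> 0" for a b
      using that unfolding exists_Z4 by (auto simp: ax_def ay_def)
    \<comment> \<open>The two nonzero coordinates either share one of the pairs 1, 2 and 3, 4, which
      gives an apex, or are split between them, which gives a vertex of the cube.\<close>
    consider "x$1 \<noteq> 0" "x$2 \<noteq> 0" "x$3 = 0" "x$4 = 0" | "x$1 = 0" "x$2 = 0" "x$3 \<noteq> 0" "x$4 \<noteq> 0"
      | "x$1 = 0 \<longleftrightarrow> x$2 \<noteq> 0" "x$3 = 0 \<longleftrightarrow> x$4 \<noteq> 0"
      using \<open>card _ = 2\<close> unfolding card by (auto split: if_splits)
    then have "\<exists>v. x = rotate24 (vert 0 v)"
    proof cases
      case 1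
      then obtain i where "x$1 = (ax i 0 + ay i 0) / 2" "x$2 = (ax i 0 - ay i 0) / 2"
        using both x by blast
      then show ?thesis
        using 1 by (intro exI[of _ "V' i"]) (simp add: rotate24_def vec_eq_iff forall_4)
    next
      case 2
      then obtain j where "x$3 = (ax j 0 + ay j 0) / 2" "x$4 = (ax j 0 - ay j 0) / 2"
        using both x by blast
      then show ?thesis
        using 2 by (intro exI[of _ "V'' j"]) (simp add: rotate24_def vec_eq_iff forall_4)
    next
      case 3
      then obtain i j where "x$1 = (sx i + sy i) / 2" "x$2 = (sx i - sy i) / 2"
        "x$3 = (sx j + sy j) / 2" "x$4 = (sx j - sy j) / 2"
        using mixed[OF x(1,2)] mixed[OF x(3,4)] by blast
      then show ?thesis
        by (intro exI[of _ "V i j"]) (simp add: rotate24_def vec_eq_iff forall_4)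
    qed
    then show "x \<in> range (\<lambda>v. rotate24 (vert 0 v))" by blast
  next
    fix x assume "x \<in> range (\<lambda>v. rotate24 (vert 0 v))"
    then obtain v where v: "x = rotate24 (vert 0 v)" by blast
    show "x \<in> {x. (\<forall>i. x $ i \<in> {-1, 0, 1}) \<and> card {i. x $ i \<noteq> 0} = 2}"
      unfolding mem_Collect_eq card forall_4
      using exhaust_Z4 by (cases v) (force simp: v rotate24_def sx_def sy_def ax_def ay_def)+
  qed
  then show ?thesis
    unfolding cell24_def by (simp add: convex_hull_linear_image[OF linear_rotate24] image_image)
qed

theorem mainTheorem10:
  shows "4 \<le> cell_dimension
           (projective_realisation_space E44 :: ((real^4)^e44_vertex) set topology) \<and>
         inclusion_isomorphic (face_lattice cell24) E44 \<and>
         \<not> projectively_unique cell24"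
proof (intro conjI)
  obtain a r where ball: "r > 0" "cball a r \<subseteq> unit_box"
    and inj: "\<forall>c\<in>cball a r. \<forall>d\<in>cball a r.
       projectively_equivalent (convex hull (range (vert c))) (convex hull (range (vert d))) \<longrightarrow> c = d"
    using ball_of_inequivalent_vert by (elim exE conjE)
  have "embedding_map (top_of_set (cball a r)) (projective_realisation_space E44)
     (\<lambda>c. projective_rel E44 `` {vert_tuple c})"
    using inj by (intro embedding_projective_classes compact_cball ball(2)) simp
  from cell_dimension_ge[OF ball(1) this]
  show "4 \<le> cell_dimension (projective_realisation_space E44 :: ((real^4)^e44_vertex) set topology)"
    by (simp add: numeral_eq_enat)
  have "0 \<in> unit_box" by (simp add: unit_box_def)
  then show cell24: "inclusion_isomorphic (face_lattice cell24) E44"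
    unfolding cell24_eq
    by (intro inclusion_isomorphic_trans[OF inclusion_isomorphic_linear_image[OF linear_rotate24 inj_rotate24]]
        inclusion_isomorphic_vert)
  show "\<not> projectively_unique cell24"
  proof
    assume unique: "projectively_unique cell24"
    have equiv: "combinatorially_equivalent (convex hull (range (vert c))) cell24" if "c \<in> unit_box" for c
      unfolding combinatorially_equivalent_def
      by (rule inclusion_isomorphic_trans[OF inclusion_isomorphic_vert[OF that] inclusion_isomorphic_sym[OF cell24]])
    have polytope: "polytope (convex hull (range (vert c)))" for c
      by (simp add: polytope_convex_hull)
    \<comment> \<open>Any second point of the ball would do: its member is combinatorially
      equivalent to that of \<open>a\<close> but not projectively.\<close>
    define b where "b = a + r *\<^sub>R axis 1 1"
    have b: "a \<in> cball a r" "b \<in> cball a r" "a \<noteq> b"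
      using ball(1) by (auto simp: b_def dist_norm axis_eq_0_iff)
    then have "projectively_equivalent (convex hull (range (vert a))) (convex hull (range (vert b)))"
      using unique equiv polytope ball(2) unfolding projectively_unique_def by blast
    then show False using inj b by blast
  qed
qed

end
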